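(* Let $n>1$ be an odd integer and let $a$ be a real number with $0<a<1$. Let $g(\alpha,a,n)$ be the pizza inequity function and, for $\alpha\in\mathbb{R}$, let $f_a(\alpha)=g(\alpha,a,n)/a$. Let $$M_a=\sum_m\frac{4n}{\pi m}\,|P_m(a)|,$$ where $m$ ranges over all positive odd multiples of $n$ and $P_m$ is the power series defined in the context. Then $$f_a\!\left(\frac{\pi}{2n}\right)=(-1)^{(n+1)/2}M_a\quad\text{and}\quad f_a\!\left(-\frac{\pi}{2n}\right)=(-1)^{(n-1)/2}M_a .$$ The maximum and minimum values of $f_a$ are $M_a$ and $-M_a$, respectively. Moreover, $$0<M_a<\frac{a^{n-1}}{2(1-a^2)(1-a^{2n})}.$$ Consequently, for all $\alpha$, $$|g(\alpha,a,n)|<\frac{a^n}{2(1-a^2)(1-a^{2n})}.$$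
   Context: Consider the circular pizza $(x-a)^2+y^2\le 1$, of radius $1$ and center $(a,0)$; since $0<a<1$ the origin is a noncentral interior point. For a real angle $\alpha$, take the $2n$ rays starting from the origin and making angles $\alpha,\alpha+\pi/n,\ldots,\alpha+(2n-1)\pi/n$ with the positive $x$-axis. They divide the pizza into $2n$ slices, numbered counterclockwise: for $k=1,\dots,2n$ the $k$-th slice is the region of the pizza between the ray at angle $\alpha+(k-1)\pi/n$ and the ray at angle $\alpha+k\pi/n$. The pizza inequity function $g(\alpha,a,n)$ is the total area of the even numbered slices minus the total area of the odd numbered slices. Equivalently, with $r(\theta)=a\cos\theta+\sqrt{1-a^2\sin^2\theta}$ the polar equation of the circle, $A=\bigcup_{k\text{ even},\,1\le k\le 2n}[\alpha+(k-1)\pi/n,\alpha+k\pi/n]$ and $B=\bigcup_{k\text{ odd},\,1\le k\le 2n}[\alpha+(k-1)\pi/n,\alpha+k\pi/n]$, one has $2g(\alpha,a,n)=\int_A r(\theta)^2\,d\theta-\int_B r(\theta)^2\,d\theta$. For an odd integer $m>1$, $P_m(x)=\sum_{j=1}^\infty c_{2j}(m)x^{2j}$, where $$c_{2j}(m)=(-1)^j\binom{1/2}{j}\int_0^{2\pi}\cos\theta\,\cos m\theta\,\sin^{2j}\theta\,d\theta$$ and $\binom{1/2}{j}=\frac{(1/2)(1/2-1)\cdots(1/2-j+1)}{j!}$. *)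

theory Defs
  imports "HOL-Analysis.Analysis"
begin

definition pizza :: "real \<Rightarrow> (real^2) set" where
  "pizza a = {p. (p$1 - a)\<^sup>2 + (p$2)\<^sup>2 \<le> 1}"

definition pizza_slice :: "real \<Rightarrow> real \<Rightarrow> nat \<Rightarrow> nat \<Rightarrow> (real^2) set" where
  "pizza_slice \<alpha> a n k = {p \<in> pizza a. \<exists>r\<ge>0.
     \<exists>\<theta>\<in>{\<alpha> + (real k - 1) * pi / real n .. \<alpha> + real k * pi / real n}.
       p = vector [r * cos \<theta>, r * sin \<theta>]}"

definition pizza_inequity :: "real \<Rightarrow> real \<Rightarrow> nat \<Rightarrow> real" where
  "pizza_inequity \<alpha> a n =
     (\<Sum>k | k \<in> {1..2*n} \<and> even k. measure lebesgue (pizza_slice \<alpha> a n k)) -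
     (\<Sum>k | k \<in> {1..2*n} \<and> odd k. measure lebesgue (pizza_slice \<alpha> a n k))"

definition normalized_inequity :: "real \<Rightarrow> nat \<Rightarrow> real \<Rightarrow> real" where
  "normalized_inequity a n \<alpha> = pizza_inequity \<alpha> a n / a"

text \<open>\<open>pizza_coeff m j\<close> is the coefficient $c_{2j}(m)$; the index is halved.\<close>

definition pizza_coeff :: "nat \<Rightarrow> nat \<Rightarrow> real" where
  "pizza_coeff m j = (-1) ^ j * ((1/2) gchoose j) *
     integral {0..2*pi} (\<lambda>\<theta>. cos \<theta> * cos (real m * \<theta>) * sin \<theta> ^ (2*j))"

text \<open>The series starts at $j = 1$, hence the shift by \<open>Suc\<close>.\<close>

definition pizza_series :: "nat \<Rightarrow> real \<Rightarrow> real" where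
  "pizza_series m x = (\<Sum>j. pizza_coeff m (Suc j) * x ^ (2 * Suc j))"

text \<open>An unordered sum over the positive odd multiples of \<open>n\<close>. Since \<open>infsum\<close> is 0 on families
  that are not summable, positivity of \<open>pizza_bound a n\<close> entails convergence.\<close>

definition pizza_bound :: "real \<Rightarrow> nat \<Rightarrow> real" where
  "pizza_bound a n =
     (\<Sum>\<^sub>\<infinity>m\<in>{m. 0 < m \<and> odd m \<and> n dvd m}. 4 * real n / (pi * real m) * \<bar>pizza_series m a\<bar>)"

lemma abs_half_gchoose_le_1: "\<bar>(1/2::real) gchoose j\<bar> \<le> 1"
proof (induction j)
  case (Suc j)
  have "((1/2::real) gchoose Suc j) = ((1/2 - real j) / real (Suc j)) * ((1/2) gchoose j)"
    by (simp add: gbinomial_absorption' gbinomial_factors field_simps gbinomial_Suc_rec)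
  moreover have "\<bar>(1/2 - real j) / real (Suc j)\<bar> \<le> 1"
    by (auto simp: abs_le_iff field_simps)
  ultimately show ?case
    using Suc by (simp only: abs_mult) (rule mult_le_one; simp)
qed simp

lemma abs_pizza_coeff_le: "\<bar>pizza_coeff m j\<bar> \<le> 2 * pi"
proof -
  let ?f = "\<lambda>\<theta>::real. cos \<theta> * cos (real m * \<theta>) * sin \<theta> ^ (2*j)"
  have "norm (integral {0..2*pi} ?f) \<le> 1 * (2*pi - 0)"
  proof (rule integral_bound)
    show "norm (?f t) \<le> 1" for t
    proof -
      have "\<bar>sin t\<bar> ^ (2*j) \<le> 1" by (rule power_le_one) auto
      then show ?thesis
        by (simp only: real_norm_def abs_mult power_abs) (intro mult_le_one; simp)
    qed
  qed (auto intro!: continuous_intros)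
  then have "\<bar>(1/2::real) gchoose j\<bar> * \<bar>integral {0..2*pi} ?f\<bar> \<le> 1 * (2 * pi)"
    by (intro mult_mono abs_half_gchoose_le_1) auto
  then show ?thesis by (simp add: pizza_coeff_def abs_mult)
qed

lemma summable_pizza_series:
  assumes "\<bar>x\<bar> < 1"
  shows "summable (\<lambda>j. pizza_coeff m (Suc j) * x ^ (2 * Suc j))"
proof (rule summable_comparison_test')
  have "x\<^sup>2 < 1" using assms by (simp add: abs_square_less_1)
  then show "summable (\<lambda>j. 2 * pi * x\<^sup>2 * (x\<^sup>2) ^ j)"
    by (intro summable_mult summable_geometric) auto
next
  fix j
  have "\<bar>pizza_coeff m (Suc j)\<bar> * (x\<^sup>2) ^ Suc j \<le> 2 * pi * (x\<^sup>2) ^ Suc j"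
    by (intro mult_right_mono abs_pizza_coeff_le) auto
  then show "norm (pizza_coeff m (Suc j) * x ^ (2 * Suc j)) \<le> 2 * pi * x\<^sup>2 * (x\<^sup>2) ^ j"
    by (simp only: power_mult real_norm_def abs_mult) (simp add: mult.assoc)
qed

end

theory Submission
  imports Defs
begin

text \<open>
  Polar coordinates give slice \<open>k\<close> the area $\frac12\int r^2$ with
  $r(\theta)^2 = 1 + a^2\cos 2\theta + 2a\cos\theta\sqrt{1 - a^2\sin^2\theta}$. In the alternating
  sum over the slices only the last summand survives, and by the binomial series it has the
  antiderivative $\sum_j d_j \sin^{2j+1}\theta$. Expanding the odd powers of the sine into multiple
  angles, the alternating sum over the $2n$ cutting rays kills every frequency that is not a multiple
  of $n$. Interchanging the two summations yields
  $$f_a(\alpha) = \sum_m \frac{4n}{\pi m} P_m(a) \sin m\alpha$$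
  without the Fourier series of a square wave. All coefficients of $P_m$ have the sign
  $(-1)^{(m+1)/2}$, and at $\alpha = \pm\pi/2n$ the signs of $\sin m\alpha$ make all summands agree in
  sign; hence these are the extrema. A termwise comparison with geometric series bounds $M_a$.
\<close>

section \<open>Area in polar coordinates\<close>

text \<open>Transfers Fubini's theorem for continuous integrands from pairs to
  \<open>real^2\<close>: the coordinate bijection maps boxes to boxes of the same content, so
  \<open>has_integral_twiddle\<close> applies with factor 1.\<close>

lemma integral_cbox_vec2:
  fixes f :: "real \<Rightarrow> real \<Rightarrow> real"
  assumes "continuous_on (cbox (a, c) (b, d)) (\<lambda>(x, y). f x y)"
  shows "((\<lambda>p::real^2. f (p$1) (p$2)) has_integral integral {a..b} (\<lambda>x. integral {c..d} (f x)))
    (cbox (vector [a, c]) (vector [b, d]))"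
proof -
  let ?g = "\<lambda>p::real^2. (p$1, p$2)" and ?h = "\<lambda>(x::real, y::real). vector [x, y] :: real^2"
  have vec: "vector [p$1, p$2] = p" for p :: "real^2"
    by (simp add: vec_eq_iff forall_2)
  have ex_2: "(\<exists>i::2. P i) \<longleftrightarrow> P 1 \<or> P 2" for P
    by (metis exhaust_2)
  have cbox_vec: "x \<in> cbox u v \<longleftrightarrow> (u$1 \<le> x$1 \<and> x$1 \<le> v$1) \<and> (u$2 \<le> x$2 \<and> x$2 \<le> v$2)"
    for x u v :: "real^2"
    by (auto simp: mem_box_cart forall_2)
  have g: "?g ` cbox u v = cbox (u$1, u$2) (v$1, v$2)" for u v :: "real^2"
  proof (rule set_eqI)
    show "z \<in> ?g ` cbox u v \<longleftrightarrow> z \<in> cbox (u$1, u$2) (v$1, v$2)" for z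
      by (cases z) (auto simp: cbox_vec image_iff cbox_Pair_eq intro!: bexI[of _ "?h z"])
  qed
  have h: "?h ` cbox u v = cbox (?h u) (?h v)" for u v :: "real \<times> real"
  proof (rule set_eqI)
    show "z \<in> ?h ` cbox u v \<longleftrightarrow> z \<in> cbox (?h u) (?h v)" for z
    proof -
      have "(\<exists>x\<in>cbox u v. z = ?h x) \<longleftrightarrow> ?g z \<in> cbox u v"
        by (auto simp: vec intro!: bexI[of _ "?g z"])
      then show ?thesis by (cases u; cases v) (auto simp: cbox_vec image_iff cbox_Pair_eq)
    qed
  qed
  have content: "measure lborel (cbox (u$1, u$2) (v$1, v$2)) = measure lborel (cbox u v)" for u v :: "real^2"
    by (auto simp: content_Pair content_cbox_if_cart interval_eq_empty_cart UNIV_2 ex_2)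
  have "((\<lambda>(x, y). f x y) has_integral integral {a..b} (\<lambda>x. integral {c..d} (f x)))
      (cbox (a, c) (b, d))"
    using integral_prod_continuous[OF assms] integrable_continuous[OF assms]
    by (simp add: has_integral_iff)
  then have "((\<lambda>p. (\<lambda>(x, y). f x y) (?g p)) has_integral
      (1 / 1) *\<^sub>R integral {a..b} (\<lambda>x. integral {c..d} (f x))) (?h ` cbox (a, c) (b, d))"
    by (intro has_integral_twiddle)
      (use g h content in \<open>auto simp: vec intro!: continuous_intros\<close>)
  then show ?thesis by (simp add: h)
qed

text \<open>The change of variables is $(t, \theta) \mapsto t R(\theta) (\cos\theta, \sin\theta)$ on a box, with
  Jacobian determinant $t R(\theta)^2$; this avoids integrating over a non-rectangular region.\<close>

lemma measure_polar_region:
  assumes R: "\<And>\<theta>. (R has_real_derivative R' \<theta>) (at \<theta>)" and pos: "\<And>\<theta>. R \<theta> > 0"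
    and lu: "l \<le> u" "u - l < 2 * pi"
  shows "measure lebesgue {vector [r * cos \<theta>, r * sin \<theta>] :: real^2 | r \<theta>.
      \<theta> \<in> {l..u} \<and> 0 \<le> r \<and> r \<le> R \<theta>} = integral {l..u} (\<lambda>\<theta>. (R \<theta>)\<^sup>2) / 2"
proof -
  let ?f = "\<lambda>p::real^2. vector [p$1 * R (p$2) * cos (p$2), p$1 * R (p$2) * sin (p$2)] :: real^2"
  define D :: "real^2 \<Rightarrow> real^2 \<Rightarrow> real^2" where "D = (\<lambda>p h. vector
     [h$1 * (R (p$2) * cos (p$2)) + h$2 * (p$1 * (R' (p$2) * cos (p$2) - R (p$2) * sin (p$2))),
      h$1 * (R (p$2) * sin (p$2)) + h$2 * (p$1 * (R' (p$2) * sin (p$2) + R (p$2) * cos (p$2)))] :: real^2)"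
  let ?box = "cbox (vector [0, l]) (vector [1, u]) :: (real^2) set"
  \<comment> \<open>The edge t = 0 is removed because the map collapses it to the origin and would
    not be injective. The edge is negligible, and its removal costs only the origin in the
    image.\<close>
  let ?S = "?box - {p. p$1 = 0}"
  let ?T = "{vector [r * cos \<theta>, r * sin \<theta>] :: real^2 | r \<theta>. \<theta> \<in> {l..u} \<and> 0 \<le> r \<and> r \<le> R \<theta>}"
  have neg: "negligible {p::real^2. p$1 = 0}"
    by (rule negligible_standard_hyperplane_cart)
  have cont_R: "continuous_on A R" for A
    using R by (meson DERIV_isCont continuous_at_imp_continuous_on)
  have der: "(?f has_derivative D p) (at p within ?S)" for p :: "real^2"
  proof (rule has_derivative_at_withinI)
    have [derivative_intros]: "((\<lambda>p::real^2. R (p$2)) has_derivative (\<lambda>h. R' (p$2) * h$2)) (at p)" for p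
    proof -
      have "(R has_derivative (*) (R' (p$2))) (at (p$2))"
        using R has_field_derivative_imp_has_derivative by blast
      from has_derivative_compose[OF bounded_linear_imp_has_derivative[OF bounded_linear_vec_nth] this]
      show ?thesis by simp
    qed
    have [derivative_intros]: "((\<lambda>p::real^2. p $ k) has_derivative (\<lambda>h. h $ k)) (at p)" for p k
      by (rule bounded_linear_imp_has_derivative) (rule bounded_linear_vec_nth)
    have "((\<lambda>p. ?f p $ i) has_derivative (\<lambda>h. D p h $ i)) (at p)" for i
      using exhaust_2[of i]
      by (auto simp: D_def algebra_simps intro!: derivative_eq_intros)
    then show "(?f has_derivative D p) (at p)"
      by (subst has_derivative_componentwise_within) (auto simp: Basis_vec_def inner_axis)
  qed
  \<comment> \<open>The contributions containing \<open>R'\<close> cancel in the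
    determinant.\<close>
  have det: "\<bar>det (matrix (D p))\<bar> = p$1 * (R (p$2))\<^sup>2" if "p \<in> ?S" for p :: "real^2"
  proof -
    have "p$1 \<ge> 0" using that by (auto simp: mem_box_cart forall_2)
    have "det (matrix (D p)) = p$1 * (R (p$2))\<^sup>2 * (sin (p$2))\<^sup>2 + p$1 * (R (p$2))\<^sup>2 * (cos (p$2))\<^sup>2"
      by (simp only: det_2 matrix_def D_def) (simp add: axis_def algebra_simps power2_eq_square)
    then show ?thesis using \<open>p$1 \<ge> 0\<close> by (simp flip: distrib_left)
  qed
  have inj: "inj_on ?f ?S"
  proof (rule inj_onI)
    fix p q assume p: "p \<in> ?S" and q: "q \<in> ?S" and eq: "?f p = ?f q"
    have p': "0 < p$1" "l \<le> p$2" "p$2 \<le> u" and q': "0 < q$1" "l \<le> q$2" "q$2 \<le> u"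
      using p q by (auto simp: mem_box_cart forall_2 less_le)
    let ?x = "p$1 * R (p$2)" and ?y = "q$1 * R (q$2)"
    have e: "?x * cos (p$2) = ?y * cos (q$2)" "?x * sin (p$2) = ?y * sin (q$2)"
      using eq by (simp_all add: vec_eq_iff forall_2)
    have "(r * cos t)\<^sup>2 + (r * sin t)\<^sup>2 = r\<^sup>2" for r t :: real
      by (simp add: power_mult_distrib flip: distrib_left)
    then have "?x\<^sup>2 = ?y\<^sup>2" by (metis e)
    moreover have xy: "?x > 0" "?y > 0" using p' q' pos by auto
    ultimately have "?x = ?y" by (simp add: power2_eq_iff_nonneg)
    with e xy have "sin (p$2) = sin (q$2)" "cos (p$2) = cos (q$2)" by auto
    \<comment> \<open>The angles agree modulo 2 pi, and the interval is shorter than a full turn, so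
      \<open>k\<close> must be 0.\<close>
    then obtain k :: int where k: "p$2 = q$2 + 2 * pi * k"
      using sin_cos_eq_iff by blast
    have "\<bar>2 * pi * k\<bar> < 2 * pi" using k p' q' lu by simp
    then have "\<bar>real_of_int k\<bar> < 1" by (simp add: abs_mult)
    then have "k = 0" by linarith
    then have "p$2 = q$2" using k by simp
    then show "p = q" using \<open>?x = ?y\<close> pos[of "q$2"] by (simp add: vec_eq_iff forall_2)
  qed
  have image: "?f ` ?S = ?T - {0}"
  proof (intro set_eqI iffI)
    fix z assume "z \<in> ?f ` ?S"
    then obtain p where p: "p \<in> ?S" and z: "z = ?f p" by blast
    have p': "0 < p$1" "p$1 \<le> 1" "l \<le> p$2" "p$2 \<le> u"
      using p by (auto simp: mem_box_cart forall_2 less_le)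
    have "?f p \<noteq> 0"
      using p' pos[of "p$2"] sin_zero_norm_cos_one[of "p$2"] by (auto simp: vec_eq_iff forall_2)
    moreover have "?f p \<in> ?T"
      by (rule CollectI, rule exI[of _ "p$1 * R (p$2)"], rule exI[of _ "p$2"])
        (use p' pos[of "p$2"] in \<open>auto intro: mult_left_le_one_le\<close>)
    ultimately show "z \<in> ?T - {0}" using z by simp
  next
    fix z assume "z \<in> ?T - {0}"
    then obtain r \<theta> where *: "z = vector [r * cos \<theta>, r * sin \<theta>]" "l \<le> \<theta>" "\<theta> \<le> u" "0 \<le> r" "r \<le> R \<theta>"
      "z \<noteq> 0" by auto
    then have "r \<noteq> 0" by (auto simp: vec_eq_iff forall_2)
    then show "z \<in> ?f ` ?S" using * pos[of \<theta>]
      by (intro image_eqI[of _ _ "vector [r / R \<theta>, \<theta>]"])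
        (auto simp: mem_box_cart forall_2 less_imp_neq[symmetric])
  qed
  have "continuous_on (cbox (0, l) (1, u)) (\<lambda>(x, y). x * (R y)\<^sup>2)"
    by (auto simp: split_beta intro!: continuous_intros continuous_on_compose2[OF cont_R[of UNIV]])
  \<comment> \<open>The integrand is a product; the factor 1/2 is the integral of t over
    [0, 1].\<close>
  from integral_cbox_vec2[OF this]
  have "((\<lambda>p::real^2. p$1 * (R (p$2))\<^sup>2) has_integral integral {l..u} (\<lambda>\<theta>. (R \<theta>)\<^sup>2) / 2) ?box"
    using ident_has_integral[of 0 "1::real"] by (simp add: integral_unique)
  then have "((\<lambda>p::real^2. p$1 * (R (p$2))\<^sup>2) has_integral integral {l..u} (\<lambda>\<theta>. (R \<theta>)\<^sup>2) / 2) ?S"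
    by (subst has_integral_spike_set_eq[where T = ?box])
      (auto intro: negligible_subset[OF neg])
  then have int: "((\<lambda>p. \<bar>det (matrix (D p))\<bar>) has_integral integral {l..u} (\<lambda>\<theta>. (R \<theta>)\<^sup>2) / 2) ?S"
    using det by (subst has_integral_cong) auto
  have S: "?S \<in> sets lebesgue"
    using neg by (intro sets.Diff) (auto simp: negligible_iff_null_sets)
  from measure_differentiable_image_eq[OF S der inj] int
  have "measure lebesgue (?T - {0}) = integral {l..u} (\<lambda>\<theta>. (R \<theta>)\<^sup>2) / 2"
    unfolding image by (simp add: has_integral_iff)
  moreover have "?T - {0} \<in> sets lebesgue"
    using measurable_differentiable_image_eq[OF S der inj] int
    unfolding image by (auto simp: has_integral_iff)
  then have "measure lebesgue ((?T - {0}) \<union> {0}) = measure lebesgue (?T - {0})"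
    by (rule measure_Un_null_set) (auto simp flip: negligible_iff_null_sets)
  moreover have "0 \<in> ?T"
    by (rule CollectI, rule exI[of _ 0], rule exI[of _ l])
      (use pos[of l] lu in \<open>auto simp: vec_eq_iff forall_2\<close>)
  then have "(?T - {0}) \<union> {0} = ?T"
    by (simp only: insert_Diff Un_insert_right Un_empty_right)
  ultimately show ?thesis by simp
qed

section \<open>Trigonometric identities\<close>

text \<open>Expand \<open>(2 * \<i> * sin \<theta>) ^ (2*j+1)\<close> as a power of
  \<open>cis \<theta> - cis (-\<theta>)\<close> by the binomial theorem and take imaginary parts.
  The summands k and 2j+1-k agree, so half of the sum suffices, and the 2 cancels against
  \<open>2 ^ (2*j+1) = 2 * 4 ^ j\<close>.\<close>

lemma sin_power_odd:
  "sin (\<theta>::real) ^ (2*j+1) =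
    (\<Sum>i\<le>j. (-1) ^ i * real ((2*j+1) choose (j-i)) * sin (real (2*i+1) * \<theta>)) / 4 ^ j"
proof -
  let ?N = "2*j+1"
  define s where "s k = (-1) ^ k * real (?N choose k) * sin (real_of_int (int ?N - 2 * int k) * \<theta>)" for k
  \<comment> \<open>Since \<open>?N\<close> is odd, the reflection flips both the sign factor and
    the frequency, and the two changes cancel.\<close>
  have s_refl: "s (?N - k) = s k" if "k \<le> ?N" for k
  proof -
    have "real_of_int (int ?N - 2 * int (?N - k)) = - real_of_int (int ?N - 2 * int k)"
      using that by (simp add: of_nat_diff)
    moreover have "(-1::real) ^ (?N - k) = - ((-1) ^ k)"
      using that by (auto simp: minus_one_power_iff)
    moreover from calculation(1)
    have "sin (real_of_int (int ?N - 2 * int (?N - k)) * \<theta>) = - sin (real_of_int (int ?N - 2 * int k) * \<theta>)"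
      by (metis minus_mult_left sin_minus)
    ultimately show ?thesis
      unfolding s_def by (simp only: binomial_symmetric[OF that, symmetric] mult_minus_left mult_minus_right minus_minus)
  qed
  have Im_cis_mult: "Im (of_nat c * ((-1) ^ i * cis x)) = (-1) ^ i * real c * sin x" for c i x
    by (cases "even i") auto
  have cis_term: "cis \<theta> ^ k * (- cis (-\<theta>)) ^ (?N - k) =
      (-1) ^ (?N - k) * cis (real_of_int (int ?N - 2 * int (?N - k)) * \<theta>)"
    if "k \<le> ?N" for k
  proof -
    have "(- cis (-\<theta>)) ^ (?N - k) = (-1) ^ (?N - k) * cis (-\<theta>) ^ (?N - k)"
      by (rule power_minus)
    moreover have "cis \<theta> ^ k * cis (-\<theta>) ^ (?N - k) = cis (real k * \<theta> + real (?N - k) * - \<theta>)"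
      unfolding Complex.DeMoivre cis_mult ..
    moreover have "real k * \<theta> + real (?N - k) * - \<theta> = real_of_int (int ?N - 2 * int (?N - k)) * \<theta>"
      using that by (simp add: of_nat_diff algebra_simps)
    ultimately show ?thesis by (simp only: mult.left_commute[of "cis \<theta> ^ k" "(-1) ^ (?N - k)"])
  qed
  have "(2 * \<i> * complex_of_real (sin \<theta>)) ^ ?N = (cis \<theta> + - cis (-\<theta>)) ^ ?N"
    by (rule arg_cong[where f = "\<lambda>z. z ^ ?N"]) (simp add: complex_eq_iff)
  also have "\<dots> = (\<Sum>k\<le>?N. of_nat (?N choose k) *
      ((-1) ^ (?N - k) * cis (real_of_int (int ?N - 2 * int (?N - k)) * \<theta>)))"
    unfolding binomial_ring by (intro sum.cong refl) (use cis_term in \<open>simp add: mult.assoc\<close>)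
  finally have "Im ((2 * \<i> * complex_of_real (sin \<theta>)) ^ ?N) =
      Im (\<Sum>k\<le>?N. of_nat (?N choose k) *
      ((-1) ^ (?N - k) * cis (real_of_int (int ?N - 2 * int (?N - k)) * \<theta>)))"
    by simp
  also have "\<dots> = (\<Sum>k\<le>?N. s (?N - k))"
    unfolding Im_sum
  proof (intro sum.cong refl)
    fix k assume "k \<in> {..?N}"
    then have "?N choose (?N - k) = ?N choose k"
      using binomial_symmetric[of k ?N] by auto
    then show "Im (of_nat (?N choose k) *
      ((-1) ^ (?N - k) * cis (real_of_int (int ?N - 2 * int (?N - k)) * \<theta>))) = s (?N - k)"
      unfolding s_def by (simp only: Im_cis_mult)
  qed
  also have "\<dots> = (\<Sum>k\<le>?N. s k)"
    by (intro sum.cong refl s_refl) auto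
  also have "\<dots> = sum s ({..j} \<union> {j<..?N})"
    by (rule arg_cong[where f = "sum s"]) auto
  also have "\<dots> = (\<Sum>k\<le>j. s k) + (\<Sum>k\<in>{j<..?N}. s k)"
    by (rule sum.union_disjoint) auto
  also have "(\<Sum>k\<in>{j<..?N}. s k) = (\<Sum>k\<le>j. s k)"
    by (rule sum.reindex_bij_witness[of _ "\<lambda>k. ?N - k" "\<lambda>k. ?N - k"]) (use s_refl in auto)
  \<comment> \<open>With k = j - i the frequency \<open>?N\<close> - 2k becomes 2i + 1.\<close>
  also have "(\<Sum>k\<le>j. s k) = (\<Sum>i\<le>j. s (j - i))"
    by (rule sum.reindex_bij_witness[of _ "\<lambda>k. j - k" "\<lambda>k. j - k"]) auto
  also have "(\<Sum>i\<le>j. s (j - i)) = (-1) ^ j *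
      (\<Sum>i\<le>j. (-1) ^ i * real (?N choose (j-i)) * sin (real (2*i+1) * \<theta>))"
    unfolding sum_distrib_left
  proof (intro sum.cong refl)
    fix i assume i: "i \<in> {..j}"
    then have "(-1::real) ^ (j - i) = (-1) ^ j * (-1) ^ i"
      by (simp add: minus_one_power_iff)
    moreover have "int ?N - 2 * int (j - i) = int (2*i+1)" using i by auto
    ultimately show "s (j - i) =
        (-1) ^ j * ((-1) ^ i * real (?N choose (j-i)) * sin (real (2*i+1) * \<theta>))"
      by (simp only: s_def) (simp only: of_int_of_nat_eq mult.assoc)
  qed
  also have "Im ((2 * \<i> * complex_of_real (sin \<theta>)) ^ ?N) = (-1) ^ j * (2 * 4 ^ j * sin \<theta> ^ ?N)"
  proof -
    have "(2 * \<i> * complex_of_real (sin \<theta>)) ^ ?N =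
        of_real ((-1) ^ j * (2 * 4 ^ j * sin \<theta> ^ ?N)) * \<i>"
      by (simp add: power_mult power_mult_distrib power_minus[of "4 * (complex_of_real (sin \<theta>))\<^sup>2"])
    then show ?thesis by (simp only:) simp
  qed
  finally show ?thesis by (simp add: field_simps flip: distrib_left)
qed

lemma integral_cos_int:
  assumes "p \<noteq> 0"
  shows "((\<lambda>\<theta>. cos (real_of_int p * \<theta>)) has_integral 0) {0..2*pi}"
proof -
  have "((\<lambda>\<theta>. cos (real_of_int p * \<theta>)) has_integral
      sin (real_of_int p * (2*pi)) / p - sin (real_of_int p * 0) / p) {0..2*pi}"
    using assms by (intro fundamental_theorem_of_calculus)
      (auto intro!: derivative_eq_intros simp flip: has_real_derivative_iff_has_vector_derivative)
  moreover have "sin (real_of_int p * (2*pi)) = 0"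
    using sin_zero_iff_int2[of "real_of_int p * (2*pi)"] by (auto intro!: exI[of _ "2 * p"])
  ultimately show ?thesis by simp
qed

lemma integral_cos_cos:
  assumes "0 < p" "0 < q"
  shows "((\<lambda>\<theta>. cos (real p * \<theta>) * cos (real q * \<theta>)) has_integral (if p = q then pi else 0)) {0..2*pi}"
proof -
  have eq: "cos (real p * \<theta>) * cos (real q * \<theta>) =
     cos (real_of_int (int p - int q) * \<theta>) / 2 + cos (real_of_int (int p + int q) * \<theta>) / 2" for \<theta>
    by (simp add: cos_times_cos algebra_simps)
  have "((\<lambda>\<theta>. cos (real_of_int (int p - int q) * \<theta>)) has_integral (if p = q then 2 * pi else 0)) {0..2*pi}"
    using integral_cos_int[of "int p - int q"] has_integral_const_real[of "1::real" 0 "2*pi"] by auto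
  moreover have "((\<lambda>\<theta>. cos (real_of_int (int p + int q) * \<theta>)) has_integral 0) {0..2*pi}"
    using integral_cos_int[of "int p + int q"] assms by auto
  ultimately have "((\<lambda>\<theta>. cos (real_of_int (int p - int q) * \<theta>) / 2 + cos (real_of_int (int p + int q) * \<theta>) / 2)
     has_integral (if p = q then 2 * pi else 0) / 2 + 0 / 2) {0..2*pi}"
    by (intro has_integral_add has_integral_divide)
  then show ?thesis unfolding eq by (auto split: if_splits)
qed

text \<open>Differentiate both sides of \<open>sin_power_odd\<close> and divide by 2j+1.\<close>

lemma cos_sin_power_even:
  "cos \<theta> * sin (\<theta>::real) ^ (2*j) =
    (\<Sum>i\<le>j. (-1) ^ i * real ((2*j+1) choose (j-i)) * real (2*i+1) * cos (real (2*i+1) * \<theta>)) /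
    (real (2*j+1) * 4 ^ j)"
proof -
  have "((\<lambda>\<theta>. sin \<theta> ^ (2*j+1)) has_real_derivative real (2*j+1) * sin \<theta> ^ (2*j) * cos \<theta>) (at \<theta>)"
    using DERIV_power[OF DERIV_sin, of "2*j+1" \<theta>] by (simp add: mult_ac)
  moreover have "((\<lambda>\<theta>. sin \<theta> ^ (2*j+1)) has_real_derivative
     (\<Sum>i\<le>j. (-1) ^ i * real ((2*j+1) choose (j-i)) * (cos (real (2*i+1) * \<theta>) * real (2*i+1))) / 4 ^ j) (at \<theta>)"
    unfolding sin_power_odd
    by (intro DERIV_cdivide DERIV_sum DERIV_cmult DERIV_fun_sin DERIV_cmult_Id)
  ultimately have "real (2*j+1) * sin \<theta> ^ (2*j) * cos \<theta> =
     (\<Sum>i\<le>j. (-1) ^ i * real ((2*j+1) choose (j-i)) * (cos (real (2*i+1) * \<theta>) * real (2*i+1))) / 4 ^ j"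
    by (rule DERIV_unique)
  then have eq: "real (2*j+1) * sin \<theta> ^ (2*j) * cos \<theta> =
     (\<Sum>i\<le>j. (-1) ^ i * real ((2*j+1) choose (j-i)) * real (2*i+1) * cos (real (2*i+1) * \<theta>)) / 4 ^ j"
    by (simp only: mult_ac)
  have cancel: "t * s = S / (c * d)" if "c * s * t = S / d" "c \<noteq> 0" for c d s t S :: real
  proof -
    have "S / (c * d) = S / d / c" by (simp add: mult.commute)
    then show ?thesis by (simp add: that(2) flip: that(1))
  qed
  show ?thesis by (rule cancel[OF eq]) simp
qed

text \<open>By orthogonality of the cosines, the integral picks out the coefficient of frequency
  2i+1 in the expansion of \<open>cos_sin_power_even\<close>. That expansion stops at frequency
  2j+1, which is why the coefficient vanishes for j < i.\<close>

lemma pizza_coeff_odd: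
  "pizza_coeff (2*i+1) j = (if i \<le> j then (-1) ^ (i+j) * ((1/2) gchoose j) *
     (pi * real (2*i+1) * real ((2*j+1) choose (j-i)) / (real (2*j+1) * 4 ^ j)) else 0)"
proof -
  let ?m = "2*i+1"
  let ?c = "\<lambda>k. (-1) ^ k * real ((2*j+1) choose (j-k)) * real (2*k+1)"
  let ?I = "(\<Sum>k\<le>j. ?c k * (if 2*k+1 = ?m then pi else 0)) / (real (2*j+1) * 4 ^ j)"
  have "((\<lambda>\<theta>. (\<Sum>k\<le>j. ?c k * (cos (real (2*k+1) * \<theta>) * cos (real ?m * \<theta>))) / (real (2*j+1) * 4 ^ j))
      has_integral ?I) {0..2*pi}"
    by (intro has_integral_divide has_integral_sum has_integral_mult_right integral_cos_cos) auto
  moreover have "(\<Sum>k\<le>j. ?c k * (cos (real (2*k+1) * \<theta>) * cos (real ?m * \<theta>))) / (real (2*j+1) * 4 ^ j) =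
     cos \<theta> * cos (real ?m * \<theta>) * sin \<theta> ^ (2*j)" for \<theta>
  proof -
    have "cos \<theta> * cos (real ?m * \<theta>) * sin \<theta> ^ (2*j) = (cos \<theta> * sin \<theta> ^ (2*j)) * cos (real ?m * \<theta>)"
      by simp
    also have "\<dots> = (\<Sum>k\<le>j. ?c k * (cos (real (2*k+1) * \<theta>) * cos (real ?m * \<theta>))) / (real (2*j+1) * 4 ^ j)"
      unfolding cos_sin_power_even by (simp add: sum_distrib_right mult.assoc)
    finally show ?thesis ..
  qed
  moreover have "(\<Sum>k\<le>j. ?c k * (if 2*k+1 = ?m then pi else 0)) = (if i \<le> j then ?c i * pi else 0)"
  proof -
    have "(\<Sum>k\<le>j. ?c k * (if 2*k+1 = ?m then pi else 0)) = (\<Sum>k\<le>j. if i = k then ?c i * pi else 0)"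
      by (intro sum.cong) auto
    then show ?thesis by (simp add: sum.delta')
  qed
  ultimately have "integral {0..2*pi} (\<lambda>\<theta>. cos \<theta> * cos (real ?m * \<theta>) * sin \<theta> ^ (2*j)) =
    (if i \<le> j then ?c i * pi else 0) / (real (2*j+1) * 4 ^ j)"
    by (simp add: integral_unique)
  then show ?thesis unfolding pizza_coeff_def by (simp add: power_add)
qed

text \<open>The factor $(-1)^k$ shifts the phase by $k\pi$, so the terms are sines of an arithmetic
  progression with step $\beta = \pi(n + p)/n$; multiplied by $2\sin(\beta/2)$ they telescope.\<close>

lemma alternating_sum_sin_eq_0:
  assumes "n > 0" "\<not> int (2 * n) dvd int n + p"
  shows "(\<Sum>k=1..2*n. (-1) ^ k * sin (real_of_int p * (\<alpha> + real k * pi / real n))) = 0"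
proof -
  define \<beta> where "\<beta> = pi * (real n + p) / real n"
  define x where "x = p * \<alpha>"
  have shift: "(-1) ^ k * sin (real_of_int p * (\<alpha> + real k * pi / real n)) = sin (x + k * \<beta>)" for k
  proof -
    have "x + k * \<beta> = real_of_int p * (\<alpha> + real k * pi / real n) + real k * pi"
      using assms(1) by (simp add: x_def \<beta>_def field_simps)
    then show ?thesis by (simp add: sin_add mult.commute)
  qed
  let ?c = "\<lambda>k. cos (x + (real k + 1/2) * \<beta>)"
  have "2 * sin (\<beta>/2) * (\<Sum>k=1..2*n. sin (x + k * \<beta>)) = (\<Sum>k=1..2*n. ?c (k - 1) - ?c k)"
    unfolding sum_distrib_left
  proof (intro sum.cong refl)
    fix k assume k: "k \<in> {1..2*n}"
    have "cos (y - \<beta>/2) - cos (y + \<beta>/2) = 2 * sin (\<beta>/2) * sin y" for y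
      by (simp add: cos_add cos_diff)
    from this[of "x + k * \<beta>"]
    show "2 * sin (\<beta>/2) * sin (x + k * \<beta>) = ?c (k - 1) - ?c k"
      using k by (simp add: of_nat_diff algebra_simps)
  qed
  also have "\<dots> = ?c 0 - ?c (2*n)"
    using sum_telescope''[of 0 "2*n" "\<lambda>k. - ?c k"] by (simp add: sum_subtractf)
  \<comment> \<open>Over 2n steps the phase grows by 2n\<beta> = 2 pi (n + p), a whole number of
    turns, so the end points of the telescoped sum cancel.\<close>
  also have "?c (2*n) = cos (x + (1/2) * \<beta> + 2 * pi * real_of_int (int n + p))"
    using assms(1) by (simp add: \<beta>_def field_simps)
  also have "\<dots> = ?c 0"
    using cos.plus_of_int[of "x + (1/2) * \<beta>" "int n + p"] by (simp add: algebra_simps)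
  finally have "2 * sin (\<beta>/2) * (\<Sum>k=1..2*n. sin (x + k * \<beta>)) = 0" by simp
  \<comment> \<open>A zero here would make \<open>n + p\<close> a multiple of 2n; this is the only
    use of the divisibility hypothesis.\<close>
  moreover have "sin (\<beta>/2) \<noteq> 0"
  proof
    assume "sin (\<beta>/2) = 0"
    then obtain i :: int where "\<beta>/2 = i * pi" using sin_zero_iff_int2 by blast
    then have "pi * real_of_int (int n + p) = pi * real_of_int (int (2 * n) * i)"
      using assms(1) by (simp add: \<beta>_def field_simps)
    then have "real_of_int (int n + p) = real_of_int (int (2 * n) * i)"
      by (simp only: mult_left_cancel[OF pi_neq_zero])
    then have "int n + p = int (2 * n) * i" by (rule of_int_eq_iff[THEN iffD1])
    then show False using assms(2) by simp
  qed
  ultimately show ?thesis by (simp add: shift)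
qed

text \<open>If p = nq, then q is odd and the k-th ray shifts the phase by qk pi. The resulting sign
  \<open>(-1) ^ k\<close> undoes the alternation, and all 2n summands coincide. Otherwise n does not
  divide n + p, so neither does 2n, and the sum vanishes.\<close>

lemma alternating_sum_sin_odd:
  assumes "odd n" "odd p"
  shows "(\<Sum>k=1..2*n. (-1) ^ k * sin (real p * (\<alpha> + real k * pi / real n))) =
    (if n dvd p then 2 * real n * sin (real p * \<alpha>) else 0)"
proof (cases "n dvd p")
  case True
  then obtain q where q: "p = n * q" by blast
  have n: "n > 0" using assms(1) by (rule odd_pos)
  have "(-1) ^ k * sin (real p * (\<alpha> + real k * pi / real n)) = sin (real p * \<alpha>)" for k
  proof -
    have "real p * (\<alpha> + real k * pi / real n) = real p * \<alpha> + real (q * k) * pi"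
      using n by (simp add: q field_simps)
    moreover have "cos (real (q * k) * pi) = (-1) ^ k" "sin (real (q * k) * pi) = 0"
      using assms q by (simp_all only: cos_npi sin_npi) (simp add: minus_one_power_iff)
    ultimately show ?thesis by (simp only: sin_add) simp
  qed
  then show ?thesis using True by simp
next
  case False
  have "\<not> int (2 * n) dvd int n + int p"
  proof
    assume "int (2 * n) dvd int n + int p"
    then have "2 * n dvd n + p" by (metis int_dvd_int_iff of_nat_add)
    then have "n dvd n + p" by (rule dvd_mult_right)
    then show False using False by simp
  qed
  then show ?thesis using alternating_sum_sin_eq_0[of n "int p" \<alpha>] False assms by (cases "n = 0") auto
qed

section \<open>The binomial series\<close>

text \<open>With the sign absorbed, consecutive coefficients have ratio (j - 1/2)/(j + 1), which
  lies strictly between 0 and 1 for j \<ge> 1. This yields the constant sign and the monotone decay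
  in the next two lemmas.\<close>

lemma gchoose_half_Suc:
  "(-1) ^ Suc j * ((1/2::real) gchoose Suc j) = (-1) ^ j * ((1/2) gchoose j) * ((real j - 1/2) / real (Suc j))"
proof -
  have "((1/2::real) gchoose Suc j) = ((1/2) gchoose j) * ((1/2 - real j) / real (Suc j))"
    by (simp add: gbinomial_absorption' gbinomial_factors field_simps gbinomial_Suc_rec)
  moreover have "(real j - 1/2) / real (Suc j) = - ((1/2 - real j) / real (Suc j))"
    by (simp add: minus_divide_left)
  ultimately show ?thesis by simp
qed

lemma gchoose_half_neg: "1 \<le> j \<Longrightarrow> (-1) ^ j * ((1/2::real) gchoose j) < 0"
proof (induction j rule: nat_induct_at_least)
  case (Suc j)
  then have "(real j - 1/2) / real (Suc j) > 0" by simp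
  from mult_neg_pos[OF Suc.IH this] show ?case unfolding gchoose_half_Suc .
qed simp

lemma gchoose_half_abs_antimono:
  assumes "1 \<le> i" "i \<le> j"
  shows "\<bar>(1/2::real) gchoose j\<bar> \<le> \<bar>(1/2) gchoose i\<bar>"
  using assms(2)
proof (induction rule: dec_induct)
  case (step k)
  have "\<bar>(1/2::real) gchoose Suc k\<bar> = \<bar>(1/2) gchoose k\<bar> * \<bar>(real k - 1/2) / real (Suc k)\<bar>"
    using arg_cong[OF gchoose_half_Suc[of k], of abs] by (simp add: abs_mult)
  also have "0 \<le> real k - 1/2" using step assms by simp
  then have "\<bar>(1/2::real) gchoose k\<bar> * \<bar>(real k - 1/2) / real (Suc k)\<bar> \<le> \<bar>(1/2) gchoose k\<bar> * 1"
    by (intro mult_left_mono) auto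
  finally show ?case using step by simp
qed simp

text \<open>An odd row is symmetric without a middle entry, so each entry occurs twice in a row of
  sum \<open>2 * 4 ^ j\<close>.\<close>

lemma choose_odd_le: "(2*j+1) choose k \<le> 4 ^ j"
proof (cases "k \<le> 2*j+1")
  case True
  let ?N = "2*j+1"
  have "2 * (?N choose k) = (\<Sum>i\<in>{k, ?N - k}. ?N choose i)"
  proof -
    have "k \<noteq> ?N - k" by presburger
    then show ?thesis using binomial_symmetric[OF True] by simp
  qed
  also have "\<dots> \<le> (\<Sum>i\<le>?N. ?N choose i)"
    using True by (intro sum_mono2) auto
  also have "\<dots> = 2 * 4 ^ j"
    unfolding choose_row_sum by (simp add: power_mult)
  finally show ?thesis by simp
next
  case False
  then show ?thesis by (simp add: binomial_eq_0)
qed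

text \<open>The coefficient of $s^{2j+1}$ in $\int_0^s \sqrt{1 - a^2 u^2}\,du$; the substitution
  $s = \sin\theta$ then gives an antiderivative of $\cos\theta\sqrt{1 - a^2\sin^2\theta}$.\<close>

definition cos_sqrt_coeff :: "real \<Rightarrow> nat \<Rightarrow> real" where
  "cos_sqrt_coeff a j = (-1) ^ j * ((1/2) gchoose j) * a ^ (2*j) / real (2*j+1)"

text \<open>Write the series as s K(s^2) with a power series K in x = s^2. Its derivative K(x) + 2x
  K'(x) has coefficients (2j+1) d_j, which clears the denominators and leaves the binomial series of
  sqrt(1 - a^2 x).\<close>

lemma
  fixes a s :: real
  assumes "0 < a" "a < 1" "\<bar>s\<bar> \<le> 1"
  shows summable_cos_sqrt_coeff: "summable (\<lambda>j. cos_sqrt_coeff a j * s ^ (2*j+1))"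
    and DERIV_cos_sqrt_coeff: "((\<lambda>s. \<Sum>j. cos_sqrt_coeff a j * s ^ (2*j+1)) has_real_derivative
      sqrt (1 - a\<^sup>2 * s\<^sup>2)) (at s)"
proof -
  let ?d = "cos_sqrt_coeff a"
  let ?K = "\<lambda>x. \<Sum>j. ?d j * x ^ j"
  \<comment> \<open>Since 1/a^2 > 1, even the end points s = 1 and s = -1 correspond to interior
    points of this disc, so termwise differentiation is valid there too.\<close>
  have sm: "summable (\<lambda>j. ?d j * x ^ j)" if "norm x < 1 / a\<^sup>2" for x
  proof (rule summable_comparison_test')
    have "a\<^sup>2 * \<bar>x\<bar> < 1" using that assms by (simp add: field_simps)
    then show "summable (\<lambda>j. (a\<^sup>2 * \<bar>x\<bar>) ^ j)" by (intro summable_geometric) simp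
    fix j
    have "\<bar>(1/2::real) gchoose j\<bar> / real (2*j+1) \<le> 1"
      using abs_half_gchoose_le_1[of j] by (simp add: divide_le_eq)
    then have "\<bar>(1/2::real) gchoose j\<bar> / real (2*j+1) * (a\<^sup>2 * \<bar>x\<bar>) ^ j \<le> 1 * (a\<^sup>2 * \<bar>x\<bar>) ^ j"
      by (intro mult_right_mono) auto
    then show "norm (?d j * x ^ j) \<le> (a\<^sup>2 * \<bar>x\<bar>) ^ j"
      by (simp add: cos_sqrt_coeff_def abs_mult power_mult_distrib power_mult power_abs)
  qed
  have inside: "norm (t\<^sup>2) < 1 / a\<^sup>2" if "\<bar>t\<bar> \<le> 1" for t :: real
  proof -
    have "t\<^sup>2 \<le> 1" using that by (simp add: abs_square_le_1)
    moreover have "a\<^sup>2 < 1" using assms by (simp add: abs_square_less_1)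
    ultimately show ?thesis using assms by (simp add: field_simps mult_le_one)
        (smt (verit) mult_left_le zero_le_power2)
  qed
  have eq: "t * ?K (t\<^sup>2) = (\<Sum>j. ?d j * t ^ (2*j+1))" if "norm (t\<^sup>2) < 1 / a\<^sup>2" for t
    unfolding suminf_mult[OF sm[OF that], symmetric] by (simp add: mult_ac flip: power_mult)
  show "summable (\<lambda>j. ?d j * s ^ (2*j+1))"
    using summable_mult[OF sm[OF inside[OF assms(3)]], of s] by (simp add: mult_ac flip: power_mult)
  define x where "x = s\<^sup>2"
  have x: "norm x < 1 / a\<^sup>2" unfolding x_def using inside assms(3) by blast
  define K' where "K' = (\<Sum>n. diffs ?d n * x ^ n)"
  have K': "(?K has_field_derivative K') (at x)"
    unfolding K'_def using sm x by (rule termdiffs_strong')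
  have "summable (\<lambda>n. diffs ?d n * x ^ n)"
    using termdiff_converges[OF x sm] by blast
  from diffs_equiv[OF this] have "(\<lambda>n. real n * ?d n * x ^ (n - Suc 0)) sums K'"
    unfolding K'_def by simp
  then have "(\<lambda>n. real n * ?d n * x ^ (n - Suc 0) * (2 * x) + ?d n * x ^ n) sums (K' * (2 * x) + ?K x)"
    by (intro sums_add sums_mult2 summable_sums sm x)
  moreover have "real n * ?d n * x ^ (n - Suc 0) * (2 * x) + ?d n * x ^ n =
      ((1/2) gchoose n) * (- (a\<^sup>2 * x)) ^ n" for n
  proof -
    have "real n * ?d n * x ^ (n - Suc 0) * (2 * x) = 2 * real n * ?d n * x ^ n"
      by (cases n) auto
    then have "real n * ?d n * x ^ (n - Suc 0) * (2 * x) + ?d n * x ^ n = real (2*n+1) * ?d n * x ^ n"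
      by (simp add: algebra_simps)
    also have "real (2*n+1) * ?d n = (-1) ^ n * ((1/2) gchoose n) * a ^ (2*n)"
      unfolding cos_sqrt_coeff_def times_divide_eq_right by (rule nonzero_mult_div_cancel_left) simp
    also have "(-1) ^ n * ((1/2) gchoose n) * a ^ (2*n) * x ^ n = ((1/2) gchoose n) * (- (a\<^sup>2 * x)) ^ n"
      by (subst power_minus) (simp add: power_mult_distrib power_mult)
    finally show ?thesis .
  qed
  ultimately have "(\<lambda>n. ((1/2) gchoose n) * (- (a\<^sup>2 * x)) ^ n) sums (K' * (2 * x) + ?K x)"
    by simp
  moreover have "(\<lambda>n. ((1/2) gchoose n) * (- (a\<^sup>2 * x)) ^ n) sums (1 + - (a\<^sup>2 * x)) powr (1/2)"
    using x assms by (intro gen_binomial_real) (simp add: abs_mult field_simps)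
  ultimately have val: "K' * (2 * x) + ?K x = (1 + - (a\<^sup>2 * x)) powr (1/2)"
    by (rule sums_unique2)
  have "((\<lambda>s. s * ?K (s\<^sup>2)) has_real_derivative K' * (2 * x) + ?K x) (at s)"
  proof -
    have "((\<lambda>s. ?K (s\<^sup>2)) has_real_derivative K' * (2 * s)) (at s)"
      by (rule DERIV_chain2[where f="?K"]) (use K' in \<open>auto simp: x_def intro!: derivative_eq_intros\<close>)
    from DERIV_mult[OF DERIV_ident this] show ?thesis
      by (simp add: x_def power2_eq_square algebra_simps)
  qed
  moreover have "(1 + - (a\<^sup>2 * x)) powr (1/2) = sqrt (1 - a\<^sup>2 * s\<^sup>2)"
    using x assms by (subst powr_half_sqrt) (auto simp: x_def field_simps)
  ultimately have "((\<lambda>s. s * ?K (s\<^sup>2)) has_real_derivative sqrt (1 - a\<^sup>2 * s\<^sup>2)) (at s)"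
    unfolding val by simp
  \<comment> \<open>The two forms of the function are identified only where the series in t^2 is
    known to converge; this set is an open neighbourhood of s.\<close>
  then show "((\<lambda>s. \<Sum>j. ?d j * s ^ (2*j+1)) has_real_derivative sqrt (1 - a\<^sup>2 * s\<^sup>2)) (at s)"
  proof (rule has_field_derivative_transform_within_open)
    show "open {t::real. norm (t\<^sup>2) < 1 / a\<^sup>2}"
      by (intro open_Collect_less continuous_intros)
  qed (use x eq in \<open>auto simp: x_def\<close>)
qed

section \<open>The alternating sum of the slices\<close>

definition circle_radius :: "real \<Rightarrow> real \<Rightarrow> real" where
  "circle_radius a \<theta> = a * cos \<theta> + sqrt (1 - a\<^sup>2 * (sin \<theta>)\<^sup>2)"

text \<open>Squared, this is a^2 < 1, that is, the origin lies inside the circle. It makes the polar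
  radius positive and the other root of the circle equation negative.\<close>

lemma abs_a_cos_less:
  assumes "0 < a" "a < (1::real)"
  shows "\<bar>a * cos \<theta>\<bar> < sqrt (1 - a\<^sup>2 * (sin \<theta>)\<^sup>2)"
proof (rule real_less_rsqrt)
  have "a\<^sup>2 < 1" using assms by (simp add: abs_square_less_1)
  moreover have "a\<^sup>2 = a\<^sup>2 * (sin \<theta>)\<^sup>2 + a\<^sup>2 * (cos \<theta>)\<^sup>2"
    by (simp flip: distrib_left)
  ultimately show "\<bar>a * cos \<theta>\<bar>\<^sup>2 < 1 - a\<^sup>2 * (sin \<theta>)\<^sup>2"
    by (simp add: power_mult_distrib)
qed

lemma mem_pizza_polar:
  assumes "0 < a" "a < 1" "0 \<le> r"
  shows "vector [r * cos \<theta>, r * sin \<theta>] \<in> pizza a \<longleftrightarrow> r \<le> circle_radius a \<theta>"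
proof -
  let ?q = "sqrt (1 - a\<^sup>2 * (sin \<theta>)\<^sup>2)"
  have pos: "1 - a\<^sup>2 * (sin \<theta>)\<^sup>2 \<ge> 0"
    using abs_a_cos_less[OF assms(1,2), of \<theta>] abs_ge_zero[of "a * cos \<theta>"]
    by (metis less_eq_real_def order_le_less_trans real_sqrt_gt_0_iff)
  have "(r * cos \<theta> - a)\<^sup>2 + (r * sin \<theta>)\<^sup>2 = r\<^sup>2 * ((sin \<theta>)\<^sup>2 + (cos \<theta>)\<^sup>2) - 2 * a * r * cos \<theta> + a\<^sup>2 * 1"
    by (simp only: distrib_left) (simp add: power2_eq_square algebra_simps)
  also have "\<dots> = (r - a * cos \<theta>)\<^sup>2 + a\<^sup>2 * (sin \<theta>)\<^sup>2"
    by (simp only: sin_cos_squared_add[of \<theta>, symmetric] distrib_left)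
      (simp add: power2_eq_square algebra_simps flip: distrib_left)
  finally have "vector [r * cos \<theta>, r * sin \<theta>] \<in> pizza a \<longleftrightarrow> (r - a * cos \<theta>)\<^sup>2 \<le> ?q\<^sup>2"
    using pos by (auto simp: pizza_def)
  also have "\<dots> \<longleftrightarrow> \<bar>r - a * cos \<theta>\<bar> \<le> ?q"
    using abs_le_square_iff[of "r - a * cos \<theta>" ?q] real_sqrt_ge_zero[OF pos] by simp
  \<comment> \<open>The lower constraint on r is automatic, because
    \<open>a * cos \<theta> - ?q\<close> is negative and r \<ge> 0.\<close>
  also have "\<dots> \<longleftrightarrow> r \<le> circle_radius a \<theta>"
    using abs_a_cos_less[OF assms(1,2), of \<theta>] assms(3) by (auto simp: circle_radius_def)
  finally show ?thesis .
qed

lemma measure_pizza_slice: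
  assumes "0 < a" "a < 1" "n > 1"
  shows "measure lebesgue (pizza_slice \<alpha> a n k) =
    integral {\<alpha> + (real k - 1) * pi / real n .. \<alpha> + real k * pi / real n} (\<lambda>\<theta>. (circle_radius a \<theta>)\<^sup>2) / 2"
proof -
  let ?l = "\<alpha> + (real k - 1) * pi / real n" and ?u = "\<alpha> + real k * pi / real n"
  have "pizza_slice \<alpha> a n k = {vector [r * cos \<theta>, r * sin \<theta>] | r \<theta>.
      \<theta> \<in> {?l..?u} \<and> 0 \<le> r \<and> r \<le> circle_radius a \<theta>}"
    unfolding pizza_slice_def using mem_pizza_polar[OF assms(1,2)] by blast
  moreover have "?u - ?l = pi / real n"
    using assms(3) by (simp add: field_simps)
  moreover have "0 < pi / real n" "pi / real n < 2 * pi"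
    using assms(3) by (auto simp: field_simps)
  moreover have der: "(circle_radius a has_real_derivative
      (- a * sin \<theta> - a\<^sup>2 * sin \<theta> * cos \<theta> / sqrt (1 - a\<^sup>2 * (sin \<theta>)\<^sup>2))) (at \<theta>)" for \<theta>
  proof -
    have "1 - a\<^sup>2 * (sin \<theta>)\<^sup>2 > 0"
      using abs_a_cos_less[OF assms(1,2), of \<theta>] abs_ge_zero[of "a * cos \<theta>"]
      by (metis order_le_less_trans real_sqrt_gt_0_iff)
    then show ?thesis unfolding circle_radius_def
      by (auto intro!: derivative_eq_intros simp: field_simps)
  qed
  moreover have pos: "circle_radius a \<theta> > 0" for \<theta>
    using abs_a_cos_less[OF assms(1,2), of \<theta>] by (auto simp: circle_radius_def abs_less_iff)
  ultimately show ?thesis using measure_polar_region[OF der pos, of ?l ?u] by simp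
qed

definition cos_sqrt_integral :: "real \<Rightarrow> real \<Rightarrow> real" where
  "cos_sqrt_integral a \<theta> = (\<Sum>j. cos_sqrt_coeff a j * sin \<theta> ^ (2*j+1))"

text \<open>\<open>F\<close> is the periodic part of the antiderivative. The linear part contributes
  the same amount to every slice and will cancel in the alternating sum.\<close>

lemma integral_circle_radius:
  assumes "0 < a" "a < 1" "l \<le> u"
  defines "F \<equiv> \<lambda>\<theta>. a\<^sup>2 / 2 * sin (2 * \<theta>) + 2 * a * cos_sqrt_integral a \<theta>"
  shows "integral {l..u} (\<lambda>\<theta>. (circle_radius a \<theta>)\<^sup>2) = (u - l) + (F u - F l)"
proof -
  have "((\<lambda>\<theta>. \<theta> + F \<theta>) has_real_derivative (circle_radius a \<theta>)\<^sup>2) (at \<theta>)" for \<theta>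
  proof -
    let ?q = "sqrt (1 - a\<^sup>2 * (sin \<theta>)\<^sup>2)"
    have q: "?q\<^sup>2 = 1 - a\<^sup>2 * (sin \<theta>)\<^sup>2"
      using abs_a_cos_less[OF assms(1,2), of \<theta>] abs_ge_zero[of "a * cos \<theta>"]
      by (metis less_eq_real_def order_le_less_trans real_sqrt_gt_0_iff real_sqrt_pow2)
    have "(cos_sqrt_integral a has_real_derivative ?q * cos \<theta>) (at \<theta>)"
      unfolding cos_sqrt_integral_def
      by (rule DERIV_chain2[where g = sin]) (use DERIV_cos_sqrt_coeff[OF assms(1,2)] in auto)
    then have "((\<lambda>\<theta>. \<theta> + F \<theta>) has_real_derivative 1 + (a\<^sup>2 / 2 * (cos (2 * \<theta>) * 2) + 2 * a * (?q * cos \<theta>))) (at \<theta>)"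
      unfolding F_def by (auto intro!: derivative_eq_intros)
    moreover have "1 + (a\<^sup>2 / 2 * (cos (2 * \<theta>) * 2) + 2 * a * (?q * cos \<theta>)) = (circle_radius a \<theta>)\<^sup>2"
      unfolding circle_radius_def power2_sum q cos_double by (simp add: power_mult_distrib algebra_simps)
    ultimately show ?thesis by simp
  qed
  then have "((\<lambda>\<theta>. (circle_radius a \<theta>)\<^sup>2) has_integral (u + F u) - (l + F l)) {l..u}"
    using assms(3) by (intro fundamental_theorem_of_calculus)
      (auto simp flip: has_real_derivative_iff_has_vector_derivative
        intro: has_field_derivative_at_within)
  then show ?thesis by (simp add: integral_unique)
qed

text \<open>Summation by parts: each ray bounds two slices of opposite sign, so its value of
  \<open>F\<close> is counted twice, which offsets the 1/2 in the area formula. The constant part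
  and the double-angle part of \<open>F\<close> sum to 0.\<close>

lemma normalized_inequity_eq_sum:
  assumes "n > 1" "odd n" "0 < a" "a < 1"
  shows "normalized_inequity a n \<alpha> =
    2 * (\<Sum>k=1..2*n. (-1) ^ k * cos_sqrt_integral a (\<alpha> + real k * pi / real n))"
proof -
  let ?\<theta> = "\<lambda>k. \<alpha> + real k * pi / real n"
  define F where "F = (\<lambda>\<theta>. a\<^sup>2 / 2 * sin (2 * \<theta>) + 2 * a * cos_sqrt_integral a \<theta>)"
  define A where "A k = measure lebesgue (pizza_slice \<alpha> a n k)" for k
  have A: "A k = (pi / real n + (F (?\<theta> k) - F (?\<theta> (k - 1)))) / 2" if "k \<in> {1..2*n}" for k
  proof -
    have "A k = integral {?\<theta> (k - 1)..?\<theta> k} (\<lambda>\<theta>. (circle_radius a \<theta>)\<^sup>2) / 2"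
      using measure_pizza_slice[OF assms(3,4,1), of \<alpha> k] that by (simp add: A_def of_nat_diff)
    moreover have "?\<theta> k - ?\<theta> (k - 1) = pi / real n"
      using that by (simp add: of_nat_diff left_diff_distrib diff_divide_distrib)
    moreover from this have "?\<theta> (k - 1) \<le> ?\<theta> k"
      using pi_gt_zero by (metis diff_ge_0_iff_ge divide_nonneg_nonneg of_nat_0_le_iff pi_ge_zero)
    ultimately show ?thesis
      using integral_circle_radius[OF assms(3,4), of "?\<theta> (k - 1)" "?\<theta> k"]
      unfolding F_def by presburger
  qed
  \<comment> \<open>Moving the index by one flips the sign, and periodicity trades the value at 0
    for the one at 2n.\<close>
  have shift: "(\<Sum>k=1..2*n. (-1) ^ k * G (k - 1)) = - (\<Sum>k=1..2*n. (-1) ^ k * G k)"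
    if "G (2*n) = G 0" for G :: "nat \<Rightarrow> real"
  proof -
    have "(\<Sum>k=1..2*n. (-1) ^ k * G (k - 1)) = - (\<Sum>k<2*n. (-1) ^ k * G k)"
      unfolding sum_negf[symmetric]
      by (rule sum.reindex_bij_witness[of _ Suc "\<lambda>k. k - 1"]) (auto simp: minus_one_power_iff)
    also have "(\<Sum>k<2*n. (-1) ^ k * G k) = (\<Sum>k\<le>2*n. (-1) ^ k * G k) - G 0"
      unfolding lessThan_Suc_atMost[symmetric] by (simp add: that)
    also have "\<dots> = (\<Sum>k=1..2*n. (-1) ^ k * G k)"
      by (simp add: atMost_atLeast0 sum.atLeast_Suc_atMost)
    finally show ?thesis .
  qed
  \<comment> \<open>For a constant the shift relation says that the sum equals its own
    negative.\<close>
  have const: "(\<Sum>k=1..2*n. (-1) ^ k * c) = 0" for c :: real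
    using shift[of "\<lambda>_. c"] by simp
  have period: "F (?\<theta> (2*n)) = F (?\<theta> 0)"
  proof -
    have "?\<theta> (2*n) = \<alpha> + 2 * pi" using assms(1) by simp
    then show ?thesis by (simp add: F_def cos_sqrt_integral_def sin_add cos_add distrib_left)
  qed
  have "pizza_inequity \<alpha> a n = (\<Sum>k=1..2*n. (-1) ^ k * A k)"
  proof -
    have "(\<Sum>k | k \<in> {1..2*n} \<and> even k. A k) = (\<Sum>k | k \<in> {1..2*n} \<and> even k. (-1) ^ k * A k)"
      by (rule sum.cong) auto
    moreover have "- (\<Sum>k | k \<in> {1..2*n} \<and> odd k. A k) = (\<Sum>k | k \<in> {1..2*n} \<and> odd k. (-1) ^ k * A k)"
      unfolding sum_negf[symmetric] by (rule sum.cong) auto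
    moreover have "(\<Sum>k=1..2*n. (-1) ^ k * A k) = (\<Sum>k | k \<in> {1..2*n} \<and> even k. (-1) ^ k * A k) +
        (\<Sum>k | k \<in> {1..2*n} \<and> odd k. (-1) ^ k * A k)"
      by (subst sum.union_disjoint[symmetric]) (auto intro!: sum.cong)
    ultimately show ?thesis unfolding pizza_inequity_def A_def[symmetric] by simp
  qed
  also have "\<dots> = (\<Sum>k=1..2*n. (-1) ^ k * (pi / real n) / 2 +
      ((-1) ^ k * F (?\<theta> k) / 2 - (-1) ^ k * F (?\<theta> (k - 1)) / 2))"
    by (intro sum.cong refl) (simp add: A algebra_simps add_divide_distrib diff_divide_distrib)
  also have "\<dots> = (\<Sum>k=1..2*n. (-1) ^ k * F (?\<theta> k))"
    using const[of "pi / real n"] shift[of "\<lambda>k. F (?\<theta> k)", OF period]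
    by (simp only: sum.distrib sum_subtractf flip: sum_divide_distrib)
  also have "\<dots> = a\<^sup>2 / 2 * (\<Sum>k=1..2*n. (-1) ^ k * sin (2 * ?\<theta> k)) +
      2 * a * (\<Sum>k=1..2*n. (-1) ^ k * cos_sqrt_integral a (?\<theta> k))"
    by (simp add: F_def sum_distrib_left sum.distrib[symmetric] algebra_simps)
  also have "(\<Sum>k=1..2*n. (-1) ^ k * sin (2 * ?\<theta> k)) = 0"
  proof -
    \<comment> \<open>For odd n the number n + 2 is odd, hence not a multiple of 2n.\<close>
    have "\<not> int (2 * n) dvd int n + 2"
      using assms(2) by (metis dvd_mult_left even_add even_of_nat even_numeral of_nat_mult of_nat_numeral)
    then show ?thesis using alternating_sum_sin_eq_0[of n 2 \<alpha>] assms(1) by simp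
  qed
  finally show ?thesis using assms(3) by (simp add: normalized_inequity_def)
qed

section \<open>The double series\<close>

text \<open>The frequency is $m = 2i + 1$.\<close>

definition pizza_term :: "nat \<Rightarrow> real \<Rightarrow> nat \<Rightarrow> nat \<Rightarrow> real" where
  "pizza_term n a i j = 4 * real n / (pi * real (2*i+1)) * (pizza_coeff (2*i+1) j * a ^ (2*j))"

lemma pizza_term_eq:
  "pizza_term n a i j = (if i \<le> j then (-1) ^ i * ((-1) ^ j * ((1/2) gchoose j)) *
     (4 * real n / real (2*j+1) * (real ((2*j+1) choose (j-i)) / 4 ^ j) * a ^ (2*j)) else 0)"
proof -
  have "4 * real n / (pi * real m) * (x * (pi * real m * c / (d * f)) * y) = x * (4 * real n / d * (c / f) * y)"
    if "m > 0" for m and x c d f y :: real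
    using that by simp
  from this[of "2*i+1"] show ?thesis
    unfolding pizza_term_def pizza_coeff_odd by (simp add: power_add mult.assoc del: of_nat_Suc of_nat_add)
qed

text \<open>The signed binomial coefficient is negative for every j \<ge> 1, so the sign depends on
  i alone. The condition i \<ge> 1 keeps out the term i = j = 0, where that coefficient is
  1.\<close>

lemma pizza_term_sgn:
  assumes "1 \<le> i" "0 < a"
  shows "pizza_term n a i j = (-1) ^ (i+1) * \<bar>pizza_term n a i j\<bar>"
proof (cases "i \<le> j")
  case True
  then have neg: "(-1) ^ j * ((1/2::real) gchoose j) < 0" using assms gchoose_half_neg by simp
  define x where "x = (-1) ^ j * ((1/2::real) gchoose j)"
  define c where "c = 4 * real n / real (2*j+1) * (real ((2*j+1) choose (j-i)) / 4 ^ j) * a ^ (2*j)"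
  have "c \<ge> 0" unfolding c_def using assms by simp
  moreover have "pizza_term n a i j = (-1) ^ i * x * c"
    using True by (simp only: pizza_term_eq c_def x_def if_True)
  moreover from this have "\<bar>pizza_term n a i j\<bar> = - x * c"
    using neg[folded x_def] \<open>c \<ge> 0\<close> by (simp add: abs_mult power_abs)
  ultimately show ?thesis by simp
qed (simp add: pizza_term_eq)

lemma pizza_term_nonzero:
  assumes "1 \<le> i" "i \<le> j" "0 < a" "0 < n"
  shows "pizza_term n a i j \<noteq> 0"
  using assms gchoose_half_neg[of j] by (auto simp: pizza_term_eq)

text \<open>For $n = 3$ and $i = j = 1$ equality holds in the first bound.\<close>

lemma pizza_term_bound:
  assumes "1 \<le> i" "n \<le> 2*i+1" "0 < a"
  shows "\<bar>pizza_term n a i j\<bar> \<le> a ^ (2*j) / 2"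
    and "3 \<le> j \<Longrightarrow> \<bar>pizza_term n a i j\<bar> < a ^ (2*j) / 2"
proof -
  let ?b = "\<bar>(1/2::real) gchoose j\<bar>" and ?c = "real ((2*j+1) choose (j-i)) / 4 ^ j"
  have eq: "\<bar>pizza_term n a i j\<bar> = (real n / real (2*j+1) * ?c) * (4 * ?b) * a ^ (2*j)" if "i \<le> j"
    using that assms(3) by (simp add: pizza_term_eq abs_mult power_abs)
  have le: "real n / real (2*j+1) * ?c \<le> 1 * 1" if "i \<le> j"
  proof (rule mult_mono)
    show "real n / real (2*j+1) \<le> 1" using that assms(2) by simp
    have "real ((2*j+1) choose (j-i)) \<le> real (4 ^ j)"
      using choose_odd_le of_nat_le_iff by blast
    then show "?c \<le> 1" by simp
  qed auto
  have le': "\<bar>pizza_term n a i j\<bar> \<le> 4 * ?b * a ^ (2*j)" if "i \<le> j"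
    unfolding eq[OF that] using le[OF that] assms(3)
    by (intro mult_right_mono mult_left_le_one_le) auto
  \<comment> \<open>\<open>4 * ?b\<close> is 1/2 at j = 2, which gives the weak bound from there on,
    and 1/4 at j = 3, which makes it strict. At j = 1 it is 2, so that case needs the exact
    term.\<close>
  have b2: "\<bar>(1/2::real) gchoose 2\<bar> = 1/8" and b3: "\<bar>(1/2::real) gchoose 3\<bar> = 1/16"
    by (simp_all add: numeral_eq_Suc gbinomial_Suc atLeast0_atMost_Suc)
  show "\<bar>pizza_term n a i j\<bar> \<le> a ^ (2*j) / 2"
  proof (cases "i \<le> j")
    case True
    show ?thesis
    proof (cases "j = 1")
      case True
      \<comment> \<open>Now n \<le> 3, and the term has absolute value n a^2 / 6.\<close>
      then have "i = 1" using \<open>i \<le> j\<close> assms(1) by simp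
      then have "real n * a\<^sup>2 \<le> 3 * a\<^sup>2" using assms(2) by (intro mult_right_mono) auto
      then show ?thesis using eq[OF \<open>i \<le> j\<close>] True \<open>i = 1\<close> by simp
    next
      case False
      then have "4 * ?b \<le> 1/2"
        using gchoose_half_abs_antimono[of 2 j] b2 True assms(1) by simp
      then have "4 * ?b * a ^ (2*j) \<le> 1/2 * a ^ (2*j)"
        by (intro mult_right_mono) auto
      then show ?thesis using le'[OF True] by simp
    qed
  next
    case False
    then show ?thesis using assms by (simp add: pizza_term_eq)
  qed
  show "\<bar>pizza_term n a i j\<bar> < a ^ (2*j) / 2" if "3 \<le> j"
  proof (cases "i \<le> j")
    case True
    have "4 * ?b \<le> 1/4"
      using gchoose_half_abs_antimono[of 3 j] b3 that by simp
    then have "4 * ?b * a ^ (2*j) \<le> 1/4 * a ^ (2*j)"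
      by (intro mult_right_mono) auto
    moreover have "a ^ (2*j) > 0" using assms by simp
    ultimately show ?thesis using le'[OF True] by linarith
  next
    case False
    then show ?thesis using assms by (simp add: pizza_term_eq)
  qed
qed

text \<open>For fixed j all sums are finite, so the sine powers can be expanded and summed over the
  rays first. The 2n equal summands of a surviving frequency and the factor 2 in front give the 4n
  in \<open>pizza_term\<close>.\<close>

lemma normalized_inequity_sums:
  assumes "n > 1" "odd n" "0 < a" "a < 1"
  shows "(\<lambda>j. \<Sum>i | i \<le> j \<and> n dvd 2*i+1. pizza_term n a i j * sin (real (2*i+1) * \<alpha>))
    sums normalized_inequity a n \<alpha>"
proof -
  let ?\<theta> = "\<lambda>k. \<alpha> + real k * pi / real n"
  have "(\<lambda>j. 2 * (\<Sum>k=1..2*n. (-1) ^ k * (cos_sqrt_coeff a j * sin (?\<theta> k) ^ (2*j+1)))) sums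
     normalized_inequity a n \<alpha>"
    unfolding normalized_inequity_eq_sum[OF assms] cos_sqrt_integral_def
    by (intro sums_mult sums_sum summable_sums summable_cos_sqrt_coeff) (use assms in auto)
  moreover have "2 * (\<Sum>k=1..2*n. (-1) ^ k * (cos_sqrt_coeff a j * sin (?\<theta> k) ^ (2*j+1))) =
      (\<Sum>i | i \<le> j \<and> n dvd 2*i+1. pizza_term n a i j * sin (real (2*i+1) * \<alpha>))" for j
  proof -
    let ?c = "\<lambda>i. (-1) ^ i * real ((2*j+1) choose (j-i)) / 4 ^ j"
    have "2 * (\<Sum>k=1..2*n. (-1) ^ k * (cos_sqrt_coeff a j * sin (?\<theta> k) ^ (2*j+1))) =
      (\<Sum>k=1..2*n. \<Sum>i\<le>j. 2 * cos_sqrt_coeff a j * ?c i * ((-1) ^ k * sin (real (2*i+1) * ?\<theta> k)))"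
      unfolding sin_power_odd by (simp add: sum_distrib_left sum_divide_distrib mult_ac)
    also have "\<dots> = (\<Sum>i\<le>j. 2 * cos_sqrt_coeff a j * ?c i *
        (\<Sum>k=1..2*n. (-1) ^ k * sin (real (2*i+1) * ?\<theta> k)))"
      unfolding sum_distrib_left by (rule sum.swap)
    also have "\<dots> = (\<Sum>i\<le>j. 2 * cos_sqrt_coeff a j * ?c i *
        (if n dvd 2*i+1 then 2 * real n * sin (real (2*i+1) * \<alpha>) else 0))"
      by (subst alternating_sum_sin_odd) (use assms in auto)
    also have "\<dots> = (\<Sum>i\<le>j. if n dvd 2*i+1 then pizza_term n a i j * sin (real (2*i+1) * \<alpha>) else 0)"
    proof (intro sum.cong refl)
      fix i assume "i \<in> {..j}"
      then have eq: "pizza_term n a i j = 2 * cos_sqrt_coeff a j * ?c i * (2 * real n)"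
        by (simp add: cos_sqrt_coeff_def pizza_term_eq)
      then show "2 * cos_sqrt_coeff a j * ?c i *
          (if n dvd 2*i+1 then 2 * real n * sin (real (2*i+1) * \<alpha>) else 0) =
          (if n dvd 2*i+1 then pizza_term n a i j * sin (real (2*i+1) * \<alpha>) else 0)"
        by (cases "n dvd 2*i+1") (simp_all only: if_True if_False mult_zero_right eq mult.assoc)
    qed
    also have "\<dots> = (\<Sum>i | i \<le> j \<and> n dvd 2*i+1. pizza_term n a i j * sin (real (2*i+1) * \<alpha>))"
      by (subst sum.inter_filter[symmetric]) auto
    finally show ?thesis .
  qed
  ultimately show ?thesis by simp
qed

section \<open>Summation over the odd multiples of n\<close>

definition pizza_indices :: "nat \<Rightarrow> nat set" where
  "pizza_indices n = {i. n dvd 2*i+1}"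

lemma pizza_indices_ge: "i \<in> pizza_indices n \<Longrightarrow> n \<le> 2*i+1"
  unfolding pizza_indices_def by (auto dest: dvd_imp_le)

lemma pizza_indices_pos: "\<lbrakk>i \<in> pizza_indices n; n > 1\<rbrakk> \<Longrightarrow> 1 \<le> i"
  using pizza_indices_ge[of i n] by simp

text \<open>The odd multiples of n are m = n(2r+1), and i = (m-1)/2 = nr + (n-1)/2. This enumeration
  turns sums over the indices into geometric series in r.\<close>

lemma bij_betw_pizza_indices:
  assumes "odd n"
  shows "bij_betw (\<lambda>r. n * r + n div 2) UNIV (pizza_indices n)"
proof (rule bij_betwI')
  have odd: "2 * (n * r + n div 2) + 1 = n * (2 * r + 1)" for r
    using assms by (simp add: algebra_simps)
  show "n * r + n div 2 \<in> pizza_indices n" for r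
    unfolding pizza_indices_def mem_Collect_eq odd by simp
  show "n * r + n div 2 = n * s + n div 2 \<longleftrightarrow> r = s" for r s
    using odd_pos[OF assms] by simp
  fix i assume "i \<in> pizza_indices n"
  then obtain q where q: "2*i+1 = n * q" unfolding pizza_indices_def by blast
  then have "odd (n * q)" by (metis even_plus_one_iff dvd_triv_left)
  then have "odd q" by simp
  then obtain r where "q = 2 * r + 1" by (rule oddE)
  then have "2*i+1 = 2 * (n * r + n div 2) + 1" using q odd by simp
  then have "i = n * r + n div 2"
    by (simp only: add_right_cancel mult_cancel1 zero_neq_numeral[symmetric] simp_thms)
  then show "\<exists>r\<in>UNIV. i = n * r + n div 2" by blast
qed

text \<open>Nonzero terms have i \<le> j, so the bound by a^(2j) is at most a^i a^j, a product of
  two geometric series. This absolute summability justifies the later interchange.\<close>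

lemma summable_pizza_term:
  assumes "n > 1" "0 < a" "a < 1"
  shows "(\<lambda>(i, j). \<bar>pizza_term n a i j\<bar>) summable_on (pizza_indices n \<times> UNIV)"
proof (rule summable_on_comparison_test)
  have geom: "((\<lambda>j. a ^ j) has_sum 1 / (1 - a)) UNIV"
    using assms geometric_sums[of a] by (intro sums_nonneg_imp_has_sum) auto
  have "(\<lambda>(i, j). a ^ i * a ^ j) summable_on (UNIV \<times> UNIV)"
  proof (rule summable_on_SigmaI[where g = "\<lambda>i. a ^ i * (1 / (1 - a))"])
    show "((\<lambda>j. case (i, j) of (i, j) \<Rightarrow> a ^ i * a ^ j) has_sum a ^ i * (1 / (1 - a))) UNIV" for i
      using has_sum_cmult_right[OF geom, of "a ^ i"] by simp
    show "(\<lambda>i. a ^ i * (1 / (1 - a))) summable_on UNIV"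
      by (rule summable_on_cmult_left[OF has_sum_imp_summable[OF geom]])
  qed (use assms in auto)
  then show "(\<lambda>(i, j). a ^ i * a ^ j) summable_on (pizza_indices n \<times> UNIV)"
    by (rule summable_on_subset_banach) auto
next
  fix p assume "p \<in> pizza_indices n \<times> (UNIV :: nat set)"
  then obtain i j where p: "p = (i, j)" "i \<in> pizza_indices n" by auto
  have "\<bar>pizza_term n a i j\<bar> \<le> a ^ i * a ^ j"
  proof (cases "i \<le> j")
    case True
    have "\<bar>pizza_term n a i j\<bar> \<le> a ^ (2*j) / 2"
      using pizza_term_bound(1) pizza_indices_pos pizza_indices_ge assms p by blast
    also have "\<dots> \<le> a ^ (2*j)" using assms by simp
    also have "\<dots> \<le> a ^ (i+j)" using True assms by (intro power_decreasing) auto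
    finally show ?thesis by (simp add: power_add)
  qed (use assms in \<open>simp add: pizza_term_eq\<close>)
  then show "(case p of (i, j) \<Rightarrow> \<bar>pizza_term n a i j\<bar>) \<le> (case p of (i, j) \<Rightarrow> a ^ i * a ^ j)"
    using p by simp
qed auto

definition pizza_amplitude :: "nat \<Rightarrow> real \<Rightarrow> nat \<Rightarrow> real" where
  "pizza_amplitude n a i = (\<Sum>\<^sub>\<infinity>j. \<bar>pizza_term n a i j\<bar>)"

text \<open>For fixed i all terms share one sign, so summing them differs from summing absolute
  values only by that sign, and |P_m(a)| is recovered exactly. The upper bound is a termwise
  comparison with a geometric series.\<close>

lemma
  assumes "n > 1" "0 < a" "a < 1" "i \<in> pizza_indices n"
  shows has_sum_pizza_amplitude: "((\<lambda>j. \<bar>pizza_term n a i j\<bar>) has_sum pizza_amplitude n a i) UNIV"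
    and has_sum_pizza_term:
      "((\<lambda>j. pizza_term n a i j) has_sum (-1) ^ (i+1) * pizza_amplitude n a i) UNIV"
    and pizza_series_eq_amplitude:
      "4 * real n / (pi * real (2*i+1)) * \<bar>pizza_series (2*i+1) a\<bar> = pizza_amplitude n a i"
    and pizza_amplitude_pos: "0 < pizza_amplitude n a i"
    and pizza_amplitude_less: "pizza_amplitude n a i < a ^ (2*i) / (2 * (1 - a\<^sup>2))"
proof -
  have i: "1 \<le> i" "n \<le> 2*i+1" using pizza_indices_pos pizza_indices_ge assms by auto
  have "(\<lambda>(i, j). \<bar>pizza_term n a i j\<bar>) summable_on (Pair i ` UNIV)"
    by (rule summable_on_subset_banach[OF summable_pizza_term[OF assms(1-3)]]) (use assms(4) in auto)
  then have "(\<lambda>j. \<bar>pizza_term n a i j\<bar>) summable_on UNIV"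
    by (subst (asm) summable_on_reindex) (auto simp: inj_on_def o_def)
  then show sum: "((\<lambda>j. \<bar>pizza_term n a i j\<bar>) has_sum pizza_amplitude n a i) UNIV"
    unfolding pizza_amplitude_def by (rule has_sum_infsum)
  from has_sum_cmult_right[OF this, of "(-1) ^ (i+1)"]
  show sum': "((\<lambda>j. pizza_term n a i j) has_sum (-1) ^ (i+1) * pizza_amplitude n a i) UNIV"
    by (simp only: pizza_term_sgn[OF i(1) assms(2), symmetric])
  show pos: "0 < pizza_amplitude n a i"
    by (rule has_sum_strict_mono[OF has_sum_0[of UNIV "\<lambda>_. 0"] sum, where x = i])
      (use pizza_term_nonzero[OF i(1), of i a n] assms in auto)
  show "4 * real n / (pi * real (2*i+1)) * \<bar>pizza_series (2*i+1) a\<bar> = pizza_amplitude n a i"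
  proof -
    let ?c = "4 * real n / (pi * real (2*i+1))"
    have "(\<lambda>j. pizza_term n a i j) sums ((-1) ^ (i+1) * pizza_amplitude n a i)"
      by (rule has_sum_imp_sums[OF sum'])
    then have "(\<lambda>j. pizza_term n a i (Suc j)) sums ((-1) ^ (i+1) * pizza_amplitude n a i)"
      \<comment> \<open>Since i \<ge> 1, the term j = 0 vanishes, which matches the start of
        \<open>pizza_series\<close> at j = 1.\<close>
      using i(1) by (simp add: sums_Suc_iff pizza_term_eq[of n a i 0])
    moreover have "(\<lambda>j. pizza_term n a i (Suc j)) sums (?c * pizza_series (2*i+1) a)"
      unfolding pizza_term_def pizza_series_def
      by (intro sums_mult summable_sums summable_pizza_series) (use assms in auto)
    ultimately have "?c * pizza_series (2*i+1) a = (-1) ^ (i+1) * pizza_amplitude n a i"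
      by (rule sums_unique2[symmetric])
    then have "\<bar>?c * pizza_series (2*i+1) a\<bar> = \<bar>(-1) ^ (i+1) * pizza_amplitude n a i\<bar>"
      by (rule arg_cong)
    then show ?thesis using pos by (simp add: abs_mult power_abs)
  qed
  have a2: "a\<^sup>2 < 1" using assms by (simp add: abs_square_less_1)
  have "((\<lambda>k. a ^ (2 * (i+k)) / 2) has_sum a ^ (2*i) / (2 * (1 - a\<^sup>2))) UNIV"
  proof (rule sums_nonneg_imp_has_sum)
    have "(\<lambda>k. a ^ (2*i) / 2 * (a\<^sup>2) ^ k) sums (a ^ (2*i) / 2 * (1 / (1 - a\<^sup>2)))"
      using a2 by (intro sums_mult geometric_sums) simp
    then show "(\<lambda>k. a ^ (2 * (i+k)) / 2) sums (a ^ (2*i) / (2 * (1 - a\<^sup>2)))"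
      by (simp add: power_add distrib_left flip: power_mult)
  qed (use assms in auto)
  moreover have image: "range ((+) i) = {i..}"
    by (auto simp: image_iff le_iff_add)
  ultimately have bound: "((\<lambda>j. a ^ (2*j) / 2) has_sum a ^ (2*i) / (2 * (1 - a\<^sup>2))) {i..}"
    using has_sum_reindex[of "\<lambda>k. i + k" UNIV "\<lambda>j. a ^ (2*j) / 2"]
    by (simp add: o_def image)
  \<comment> \<open>Dropping the zero terms j < i lets the majorant start at a^(2i). The index i + 3
    below is the witness for strictness, as the strict termwise bound requires j \<ge> 3.\<close>
  have "((\<lambda>j. \<bar>pizza_term n a i j\<bar>) has_sum pizza_amplitude n a i) {i..}"
    using sum by (subst has_sum_cong_neutral[where T = UNIV]) (auto simp: pizza_term_eq)
  then show "pizza_amplitude n a i < a ^ (2*i) / (2 * (1 - a\<^sup>2))"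
    using bound
    by (rule has_sum_strict_mono[where x = "i + 3"])
      (use pizza_term_bound(1)[OF i assms(2)] pizza_term_bound(2)[OF i assms(2), of "i + 3"] in auto)
qed

lemma has_sum_geometric_pizza_indices:
  assumes "n > 1" "odd n" "0 < a" "a < (1::real)"
  shows "((\<lambda>i. a ^ (2*i) / (2 * (1 - a\<^sup>2))) has_sum a ^ (n - 1) / (2 * (1 - a\<^sup>2) * (1 - a ^ (2*n))))
    (pizza_indices n)"
proof -
  have eq: "2 * (n * r + n div 2) = (n - 1) + 2 * n * r" for r
    using assms by (auto elim!: oddE)
  have a2: "a\<^sup>2 < 1" using assms by (simp add: abs_square_less_1)
  have "a ^ (2*n) < 1" using assms by (simp add: power_less_one_iff)
  then have "(\<lambda>r. a ^ (n - 1) / (2 * (1 - a\<^sup>2)) * (a ^ (2*n)) ^ r) sums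
      (a ^ (n - 1) / (2 * (1 - a\<^sup>2)) * (1 / (1 - a ^ (2*n))))"
    using assms by (intro sums_mult geometric_sums) simp
  then have "((\<lambda>r. a ^ (n - 1) / (2 * (1 - a\<^sup>2)) * (a ^ (2*n)) ^ r) has_sum
      (a ^ (n - 1) / (2 * (1 - a\<^sup>2)) * (1 / (1 - a ^ (2*n))))) UNIV"
    using assms a2 by (intro sums_nonneg_imp_has_sum) auto
  then have "((\<lambda>r. a ^ (2 * (n * r + n div 2)) / (2 * (1 - a\<^sup>2))) has_sum
      a ^ (n - 1) / (2 * (1 - a\<^sup>2) * (1 - a ^ (2*n)))) UNIV"
    unfolding eq power_add power_mult[symmetric] by simp
  then show ?thesis
    by (subst (asm) has_sum_reindex_bij_betw[OF bij_betw_pizza_indices[OF assms(2)], of "\<lambda>i. a ^ (2*i) / (2 * (1 - a\<^sup>2))"])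
qed

text \<open>The geometric majorant provides summability, so the \<open>infsum\<close> in
  \<open>pizza_bound\<close> is a genuine sum and not the default 0; the substitution m = 2i+1 then
  identifies the two sums.\<close>

lemma has_sum_pizza_bound:
  assumes "n > 1" "odd n" "0 < a" "a < 1"
  shows "(pizza_amplitude n a has_sum pizza_bound a n) (pizza_indices n)"
proof -
  have "pizza_amplitude n a summable_on pizza_indices n"
  proof (rule summable_on_comparison_test)
    show "(\<lambda>i. a ^ (2*i) / (2 * (1 - a\<^sup>2))) summable_on pizza_indices n"
      using has_sum_geometric_pizza_indices[OF assms] by (rule has_sum_imp_summable)
  qed (use pizza_amplitude_pos pizza_amplitude_less assms in \<open>auto intro: less_imp_le\<close>)
  then have "(pizza_amplitude n a has_sum infsum (pizza_amplitude n a) (pizza_indices n)) (pizza_indices n)"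
    by (rule has_sum_infsum)
  moreover have "pizza_bound a n = infsum (pizza_amplitude n a) (pizza_indices n)"
  proof -
    have "{m. 0 < m \<and> odd m \<and> n dvd m} = (\<lambda>i. 2*i+1) ` pizza_indices n"
    proof (intro subset_antisym subsetI)
      fix m assume m: "m \<in> {m. 0 < m \<and> odd m \<and> n dvd m}"
      then have "odd m" by simp
      then obtain i where "m = 2*i+1" by (rule oddE)
      then show "m \<in> (\<lambda>i. 2*i+1) ` pizza_indices n" using m by (auto simp: pizza_indices_def)
    qed (auto simp: pizza_indices_def)
    then have "pizza_bound a n =
        (\<Sum>\<^sub>\<infinity>i\<in>pizza_indices n. 4 * real n / (pi * real (2*i+1)) * \<bar>pizza_series (2*i+1) a\<bar>)"
      unfolding pizza_bound_def by (auto simp: infsum_reindex inj_on_def o_def)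
    also have "\<dots> = infsum (pizza_amplitude n a) (pizza_indices n)"
      by (intro infsum_cong pizza_series_eq_amplitude) (use assms in auto)
    finally show ?thesis .
  qed
  ultimately show ?thesis by simp
qed

text \<open>Interchanges the summations of \<open>normalized_inequity_sums\<close>, which has j
  outside: the factor \<open>sin\<close> has absolute value at most 1, so absolute summability
  carries over, and the inner sum over j becomes a signed amplitude.\<close>

lemma has_sum_normalized_inequity:
  assumes "n > 1" "odd n" "0 < a" "a < 1"
  shows "((\<lambda>i. (-1) ^ (i+1) * sin (real (2*i+1) * \<alpha>) * pizza_amplitude n a i) has_sum
    normalized_inequity a n \<alpha>) (pizza_indices n)"
proof -
  let ?f = "\<lambda>i j. pizza_term n a i j * sin (real (2*i+1) * \<alpha>)"
  let ?I = "pizza_indices n"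
  have summable: "(\<lambda>(i, j). ?f i j) summable_on (?I \<times> UNIV)"
  proof (rule abs_summable_summable, rule Infinite_Sum.abs_summable_on_comparison_test'[OF summable_pizza_term])
    show "norm (case p of (i, j) \<Rightarrow> ?f i j) \<le> (case p of (i, j) \<Rightarrow> \<bar>pizza_term n a i j\<bar>)" for p
      by (auto simp: abs_mult split: prod.split intro: mult_right_le_one_le)
  qed (use assms in auto)
  have summable': "(\<lambda>(j, i). ?f i j) summable_on (UNIV \<times> ?I)"
    using summable by (subst summable_on_swap) (simp add: case_prod_beta)
  have inner: "(\<Sum>\<^sub>\<infinity>j. ?f i j) = (-1) ^ (i+1) * sin (real (2*i+1) * \<alpha>) * pizza_amplitude n a i"
    if "i \<in> ?I" for i
    using has_sum_cmult_left[OF has_sum_pizza_term[OF assms(1,3,4) that], of "sin (real (2*i+1) * \<alpha>)"]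
    by (simp add: infsumI mult_ac)
  have "(\<Sum>\<^sub>\<infinity>i\<in>?I. ?f i j) = (\<Sum>i | i \<le> j \<and> n dvd 2*i+1. ?f i j)" for j
  proof -
    have "(\<Sum>\<^sub>\<infinity>i\<in>?I. ?f i j) = (\<Sum>\<^sub>\<infinity>i\<in>{i. i \<le> j \<and> n dvd 2*i+1}. ?f i j)"
      by (rule infsum_cong_neutral) (auto simp: pizza_indices_def pizza_term_eq)
    then show ?thesis by simp
  qed
  then have "(\<lambda>j. \<Sum>\<^sub>\<infinity>i\<in>?I. ?f i j) sums normalized_inequity a n \<alpha>"
    using normalized_inequity_sums[OF assms] by simp
  moreover have "(\<lambda>j. \<Sum>\<^sub>\<infinity>i\<in>?I. ?f i j) sums (\<Sum>\<^sub>\<infinity>j. \<Sum>\<^sub>\<infinity>i\<in>?I. ?f i j)"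
    by (rule has_sum_imp_sums[OF has_sum_infsum[OF summable_on_Sigma_banach[OF summable']]])
  ultimately have "normalized_inequity a n \<alpha> = (\<Sum>\<^sub>\<infinity>j. \<Sum>\<^sub>\<infinity>i\<in>?I. ?f i j)"
    by (rule sums_unique2)
  also have "\<dots> = (\<Sum>\<^sub>\<infinity>i\<in>?I. \<Sum>\<^sub>\<infinity>j. ?f i j)"
    by (rule infsum_swap_banach[OF summable, symmetric])
  finally have "((\<lambda>i. \<Sum>\<^sub>\<infinity>j. ?f i j) has_sum normalized_inequity a n \<alpha>) ?I"
    using has_sum_infsum[OF summable_on_Sigma_banach[OF summable]] by simp
  then show ?thesis using inner by (simp cong: has_sum_cong)
qed

text \<open>For m = n(2r+1) the angle is pi/2 + r pi, whose sine is \<open>(-1) ^ r\<close>. As n is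
  odd, \<open>(-1) ^ (i+1)\<close> also contributes \<open>(-1) ^ r\<close>, so the product no
  longer depends on r.\<close>

lemma sin_pizza_index:
  assumes "odd n" "i \<in> pizza_indices n"
  shows "(-1) ^ (i+1) * sin (real (2*i+1) * (pi / (2 * real n))) = (-1) ^ ((n+1) div 2)"
proof -
  obtain r where r: "i = n * r + n div 2"
    using bij_betw_pizza_indices[OF assms(1)] assms(2) by (auto simp: bij_betw_def)
  have "n > 0" using assms(1) by (rule odd_pos)
  have "2*i+1 = n * (2*r+1)" using assms by (simp add: r algebra_simps)
  then have "real (2*i+1) = real n * real (2*r+1)" by (metis of_nat_mult)
  then have "real (2*i+1) * (pi / (2 * real n)) = pi / 2 + real r * pi"
    using \<open>n > 0\<close> by (simp add: field_simps)
  then have "sin (real (2*i+1) * (pi / (2 * real n))) = (-1) ^ r"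
    by (simp only: sin_add) simp
  moreover have "(n+1) div 2 = n div 2 + 1" using assms by (auto elim!: oddE)
  moreover have "(-1::real) ^ (n * r) = (-1) ^ r" using assms by (simp add: minus_one_power_iff)
  ultimately show ?thesis by (simp add: r power_add flip: power_mult_distrib)
qed

theorem corollary1p5:
  fixes n :: nat and a :: real
  assumes "n > 1" and "odd n" and "0 < a" and "a < 1"
  shows "normalized_inequity a n (pi / (2 * real n)) = (-1) ^ ((n + 1) div 2) * pizza_bound a n \<and>
    normalized_inequity a n (- pi / (2 * real n)) = (-1) ^ ((n - 1) div 2) * pizza_bound a n \<and>
    (\<exists>\<alpha>. normalized_inequity a n \<alpha> = pizza_bound a n) \<and>
    (\<forall>\<alpha>. normalized_inequity a n \<alpha> \<le> pizza_bound a n) \<and>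
    (\<exists>\<alpha>. normalized_inequity a n \<alpha> = - pizza_bound a n) \<and>
    (\<forall>\<alpha>. - pizza_bound a n \<le> normalized_inequity a n \<alpha>) \<and>
    0 < pizza_bound a n \<and>
    pizza_bound a n < a ^ (n - 1) / (2 * (1 - a\<^sup>2) * (1 - a ^ (2 * n))) \<and>
    (\<forall>\<alpha>. \<bar>pizza_inequity \<alpha> a n\<bar> < a ^ n / (2 * (1 - a\<^sup>2) * (1 - a ^ (2 * n))))"
proof -
  let ?f = "normalized_inequity a n" and ?M = "pizza_bound a n" and ?I = "pizza_indices n"
  let ?A = "pizza_amplitude n a" and ?s = "(-1) ^ ((n + 1) div 2) :: real"
  note f = has_sum_normalized_inequity[OF assms] and M = has_sum_pizza_bound[OF assms]
  note A_pos = pizza_amplitude_pos[OF assms(1,3,4)]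
  have plus: "?f (pi / (2 * real n)) = ?s * ?M"
  proof (rule has_sum_unique[OF f])
    show "((\<lambda>i. (-1) ^ (i+1) * sin (real (2*i+1) * (pi / (2 * real n))) * ?A i) has_sum ?s * ?M) ?I"
      using has_sum_cmult_right[OF M, of ?s] sin_pizza_index[OF assms(2)]
      by (simp cong: has_sum_cong)
  qed
  have minus: "?f (- pi / (2 * real n)) = - ?s * ?M"
  proof (rule has_sum_unique[OF f])
    have "(-1) ^ (i+1) * sin (real (2*i+1) * (- pi / (2 * real n))) = - ?s" if "i \<in> ?I" for i
      using sin_pizza_index[OF assms(2) that] by simp
    then show "((\<lambda>i. (-1) ^ (i+1) * sin (real (2*i+1) * (- pi / (2 * real n))) * ?A i) has_sum - ?s * ?M) ?I"
      using has_sum_cmult_right[OF M, of "- ?s"] by (simp cong: has_sum_cong)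
  qed
  have sign: "- ?s = (-1) ^ ((n - 1) div 2)" using assms(2) by (auto elim!: oddE)
  have s: "?s = 1 \<or> ?s = -1" by (simp add: minus_one_power_iff)
  \<comment> \<open>Since |sin| \<le> 1, the sum of the amplitudes bounds the function on both
    sides; the two evaluations above show that the bounds are attained.\<close>
  have bounds: "\<bar>(-1) ^ (i+1) * sin (real (2*i+1) * \<alpha>) * ?A i\<bar> \<le> ?A i" if "i \<in> ?I" for i \<alpha>
    using A_pos[OF that] by (simp add: abs_mult power_abs mult_left_le_one_le)
  have upper: "?f \<alpha> \<le> ?M" for \<alpha>
    by (rule has_sum_mono[OF f M]) (use bounds abs_le_D1 in blast)
  have lower: "- ?M \<le> ?f \<alpha>" for \<alpha>
    by (rule has_sum_mono[OF has_sum_cmult_right[OF M, of "-1", simplified] f])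
      (use bounds abs_le_D2 in fastforce)
  \<comment> \<open>This index is the frequency m = n; it is the witness in both strict comparisons
    below.\<close>
  have n: "n div 2 \<in> ?I" using assms(2) by (simp add: pizza_indices_def)
  have pos: "0 < ?M"
    by (rule has_sum_strict_mono[OF has_sum_0[of ?I "\<lambda>_. 0"] M _ n])
      (use A_pos n in \<open>auto intro: less_imp_le\<close>)
  have less: "?M < a ^ (n - 1) / (2 * (1 - a\<^sup>2) * (1 - a ^ (2 * n)))"
    by (rule has_sum_strict_mono[OF M has_sum_geometric_pizza_indices[OF assms] _ n])
      (use pizza_amplitude_less[OF assms(1,3,4)] n in \<open>auto intro: less_imp_le\<close>)
  have "\<bar>pizza_inequity \<alpha> a n\<bar> < a ^ n / (2 * (1 - a\<^sup>2) * (1 - a ^ (2 * n)))" for \<alpha>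
  proof -
    have "\<bar>pizza_inequity \<alpha> a n\<bar> = a * \<bar>?f \<alpha>\<bar>"
      using assms(3) by (simp add: normalized_inequity_def abs_mult)
    also have "\<dots> \<le> a * ?M"
      using upper lower assms(3) by (intro mult_left_mono) (auto simp: abs_le_iff minus_le_iff)
    also have "\<dots> < a * (a ^ (n - 1) / (2 * (1 - a\<^sup>2) * (1 - a ^ (2 * n))))"
      using less assms(3) by (rule mult_strict_left_mono)
    also have "a * a ^ (n - 1) = a ^ n"
      using assms(1) by (simp add: power_eq_if)
    then have "a * (a ^ (n - 1) / (2 * (1 - a\<^sup>2) * (1 - a ^ (2 * n)))) = a ^ n / (2 * (1 - a\<^sup>2) * (1 - a ^ (2 * n)))"
      by simp
    finally show ?thesis .
  qed
  \<comment> \<open>Whichever sign \<open>?s\<close> has, one of the two points gives the maximum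
    and the other the minimum.\<close>
  moreover have "\<exists>\<alpha>. ?f \<alpha> = ?M" "\<exists>\<alpha>. ?f \<alpha> = - ?M"
    using plus minus s by auto
  ultimately show ?thesis
    using plus minus[unfolded sign] upper lower pos less by blast
qed

end
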